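(* Let $k\ge1$ and let $G,H$ be simple graphs with $|V(G)|=|V(H)|$. Then $G$ and $H$ are algebraically $k$-equivalent if and only if there is a level-$k$ quantum isomorphism map from $G$ to $H$.
   Context: Homomorphism tensors: for a $(k,k)$-bilabelled graph $\boldsymbol F=(F,\boldsymbol u,\boldsymbol v)$, $\boldsymbol F_G\in\mathbb C^{V(G)^k\times V(G)^k}$ has $(\boldsymbol x,\boldsymbol y)$-entry the number of homomorphisms $h:F\to G$ with $h(u_i)=x_i,h(v_i)=y_i$. Bilabelled minors: via edge contraction, edge deletion, deletion of unlabelled vertices. $\boldsymbol C_k$: vertices $[2k]$, in-labels $(1,\dots,k)$, out-labels $(k+1,\dots,2k)$, edges $\{i,i+1\}$ ($i\in[2k]\setminus\{k,2k\}$), $\{1,k+1\},\{k,2k\}$; $\boldsymbol M_k$: same vertices/labels, edges $\{i,i+k\}$. $\mathcal Q_k^P,\mathcal Q_k^S$ = bilabelled minors of $\boldsymbol C_k,\boldsymbol M_k$; $\mathcal Q_k$ their union. For $\sigma\in\mathfrak S_{2k}$, $(X^\sigma)_{\boldsymbol z}=X_{\boldsymbol w}$ with $w_{\sigma(i)}=z_i$ (index pairs viewed as $2k$-tuples). $\mathscr C_k$ = cyclic group of rotations of the cyclic sequence $(1,\dots,k,2k,\dots,k+1)$. $I$ identity, $J$ all-ones, $\odot$ entrywise product. Level-$k$ quantum isomorphism map from $G$ to $H$: linear $\Phi:\mathbb{C}^{V(G)^k\times V(G)^k}\to\mathbb{C}^{V(H)^k\times V(H)^k}$, completely positive, with $\Phi(\boldsymbol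 F_G\odot X)=\boldsymbol F_H\odot\Phi(X)$ for $\boldsymbol F\in\mathcal Q_k^P$, $\Phi(I)=I=\Phi^*(I)$, $\Phi(J)=J=\Phi^*(J)$ ($\Phi^*$ trace-inner-product adjoint), $\Phi(\boldsymbol F_G)=\boldsymbol F_H$ for $\boldsymbol F\in\mathcal Q_k$, $\Phi(X^\sigma)=\Phi(X)^\sigma$ for $\sigma\in\mathscr C_k$. Algebraic $k$-equivalence: $\widehat{\mathcal Q}^k_G$ is the smallest subalgebra of $\mathbb C^{V(G)^k\times V(G)^k}$ containing $I,J$, closed under conjugate transpose, under $X\mapsto\boldsymbol F_G\odot X$ for $\boldsymbol F\in\mathcal Q_k^P$, under $X\mapsto X^\sigma$ for $\sigma\in\mathscr C_k$, and containing $\boldsymbol F_G$ for all $\boldsymbol F\in\mathcal Q_k$. $G,H$ are algebraically $k$-equivalent if there is a vector space isomorphism $\varphi:\widehat{\mathcal Q}^k_G\to\widehat{\mathcal Q}^k_H$ with, for all $M,N$: $\varphi(M^* )=\varphi(M)^*$, $\varphi(MN)=\varphi(M)\varphi(N)$, $\varphi(\boldsymbol F_G\odot M)=\boldsymbol F_H\odot\varphi(M)$ ($\boldsymbol F\in\mathcal Q_k^P$), $\varphi(I)=I$, $\varphi(J)=J$, $\varphi(\boldsymbol F_G)=\boldsymbol F_H$ ($\boldsymbol F\in\mathcal Q_k$), $\varphi(M^\sigma)=\varphi(M)^\sigma$ ($\sigma\in\mathscr C_k$), and $\mathrm{tr}\,\varphi(M)=\mathrm{tr}\,M$. *)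

theory Defs
  imports "HOL-Analysis.Analysis"
begin

definition simple_graph :: "('a \<Rightarrow> 'a \<Rightarrow> bool) \<Rightarrow> bool" where
  "simple_graph adj \<longleftrightarrow> (\<forall>x y. adj x y \<longrightarrow> adj y x) \<and> (\<forall>x. \<not> adj x x)"

text \<open>A matrix in C^(V^k x V^k) is a function on lists; only lists of length k are indices,
  all other entries are required to be 0 (see tspace).\<close>
type_synonym 'a tmat = "'a list \<Rightarrow> 'a list \<Rightarrow> complex"

definition tuples :: "nat \<Rightarrow> 'a list set" where
  "tuples k = {xs. length xs = k}"

definition tspace :: "nat \<Rightarrow> 'a tmat set" where
  "tspace k = {M. \<forall>x y. \<not> (length x = k \<and> length y = k) \<longrightarrow> M x y = 0}"

definition mzero :: "'a tmat" where
  "mzero = (\<lambda>x y. 0)"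

definition madd :: "'a tmat \<Rightarrow> 'a tmat \<Rightarrow> 'a tmat" where
  "madd A B = (\<lambda>x y. A x y + B x y)"

definition msmult :: "complex \<Rightarrow> 'a tmat \<Rightarrow> 'a tmat" where
  "msmult c A = (\<lambda>x y. c * A x y)"

definition mmult :: "nat \<Rightarrow> 'a tmat \<Rightarrow> 'a tmat \<Rightarrow> 'a tmat" where
  "mmult k A B = (\<lambda>x y. \<Sum>z\<in>tuples k. A x z * B z y)"

definition mctrans :: "'a tmat \<Rightarrow> 'a tmat" where
  "mctrans A = (\<lambda>x y. cnj (A y x))"

definition mhad :: "'a tmat \<Rightarrow> 'a tmat \<Rightarrow> 'a tmat" where
  "mhad A B = (\<lambda>x y. A x y * B x y)"

definition mI :: "nat \<Rightarrow> 'a tmat" where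
  "mI k = (\<lambda>x y. if length x = k \<and> x = y then 1 else 0)"

definition mJ :: "nat \<Rightarrow> 'a tmat" where
  "mJ k = (\<lambda>x y. if length x = k \<and> length y = k then 1 else 0)"

definition mtrace :: "nat \<Rightarrow> 'a tmat \<Rightarrow> complex" where
  "mtrace k A = (\<Sum>x\<in>tuples k. A x x)"

definition tinner :: "nat \<Rightarrow> 'a tmat \<Rightarrow> 'a tmat \<Rightarrow> complex" where
  "tinner k A B = mtrace k (mmult k (mctrans A) B)"

definition munit :: "'a list \<Rightarrow> 'a list \<Rightarrow> 'a tmat" where
  "munit x y = (\<lambda>a b. if a = x \<and> b = y then 1 else 0)"

text \<open>A bilabelled graph: vertex set, edge set (edges are 2-element vertex sets),
  in-labels u and out-labels v.\<close>
record blg =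
  bV :: "nat set"
  bE :: "nat set set"
  bin :: "nat list"
  bout :: "nat list"

definition hom_tensor :: "('a \<Rightarrow> 'a \<Rightarrow> bool) \<Rightarrow> blg \<Rightarrow> 'a tmat" where
  "hom_tensor adj F = (\<lambda>x y. of_nat (card
     {h \<in> extensional (bV F).
        (\<forall>e\<in>bE F. \<forall>a\<in>e. \<forall>b\<in>e. a \<noteq> b \<longrightarrow> adj (h a) (h b))
        \<and> map h (bin F) = x \<and> map h (bout F) = y}))"

inductive_set bminors :: "blg \<Rightarrow> blg set" for F0 :: blg where
  base: "F0 \<in> bminors F0"
| del_edge: "F \<in> bminors F0 \<Longrightarrow> e \<in> bE F \<Longrightarrow>
     \<lparr>bV = bV F, bE = bE F - {e}, bin = bin F, bout = bout F\<rparr> \<in> bminors F0"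
| del_vertex: "F \<in> bminors F0 \<Longrightarrow> w \<in> bV F \<Longrightarrow> w \<notin> set (bin F) \<Longrightarrow> w \<notin> set (bout F) \<Longrightarrow>
     \<lparr>bV = bV F - {w}, bE = {e \<in> bE F. w \<notin> e}, bin = bin F, bout = bout F\<rparr> \<in> bminors F0"
| contract: "F \<in> bminors F0 \<Longrightarrow> {a, b} \<in> bE F \<Longrightarrow> a \<noteq> b \<Longrightarrow>
     \<lparr>bV = bV F - {b},
      bE = (\<lambda>e. (\<lambda>w. if w = b then a else w) ` e) ` (bE F - {{a, b}}),
      bin = map (\<lambda>w. if w = b then a else w) (bin F),
      bout = map (\<lambda>w. if w = b then a else w) (bout F)\<rparr> \<in> bminors F0"

definition Cgraph :: "nat \<Rightarrow> blg" where
  "Cgraph k = \<lparr>bV = {1..2*k},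
     bE = {{i, i+1} | i. i \<in> {1..2*k} - {k, 2*k}} \<union> {{1, k+1}, {k, 2*k}},
     bin = [1..<k+1], bout = [k+1..<2*k+1]\<rparr>"

definition Mgraph :: "nat \<Rightarrow> blg" where
  "Mgraph k = \<lparr>bV = {1..2*k},
     bE = {{i, i+k} | i. i \<in> {1..k}},
     bin = [1..<k+1], bout = [k+1..<2*k+1]\<rparr>"

definition QP :: "nat \<Rightarrow> blg set" where
  "QP k = bminors (Cgraph k)"

definition QS :: "nat \<Rightarrow> blg set" where
  "QS k = bminors (Mgraph k)"

definition Qk :: "nat \<Rightarrow> blg set" where
  "Qk k = QP k \<union> QS k"

text \<open>Positions of the 2k-tuple z = x @ y are indexed 0..2k-1 (paper position i is our i-1).
  (X^sigma)_z = X_w with w_{sigma(i)} = z_i, i.e. w_j = z_{sigma^{-1}(j)}.\<close>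
definition pact :: "nat \<Rightarrow> (nat \<Rightarrow> nat) \<Rightarrow> 'a tmat \<Rightarrow> 'a tmat" where
  "pact k \<sigma> X = (\<lambda>x y. if length x = k \<and> length y = k then
       (let z = x @ y;
            w = map (\<lambda>j. z ! inv_into {0..<2*k} \<sigma> j) [0..<2*k]
        in X (take k w) (drop k w))
     else 0)"

text \<open>The cyclic sequence (1,...,k,2k,...,k+1), 0-indexed: (0,...,k-1,2k-1,...,k).\<close>
definition cyc_seq :: "nat \<Rightarrow> nat list" where
  "cyc_seq k = [0..<k] @ rev [k..<2*k]"

definition rot :: "nat \<Rightarrow> nat \<Rightarrow> nat" where
  "rot k p = (if p < 2*k then
       cyc_seq k ! (((THE i. i < 2*k \<and> cyc_seq k ! i = p) + 1) mod (2*k))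
     else p)"

definition cyc_group :: "nat \<Rightarrow> (nat \<Rightarrow> nat) set" where
  "cyc_group k = {(rot k) ^^ j | j. True}"

definition lin_on :: "nat \<Rightarrow> ('a tmat \<Rightarrow> 'b tmat) \<Rightarrow> bool" where
  "lin_on k \<Phi> \<longleftrightarrow> (\<forall>X\<in>tspace k. \<forall>Y\<in>tspace k. \<forall>c.
      \<Phi> (madd X Y) = madd (\<Phi> X) (\<Phi> Y) \<and> \<Phi> (msmult c X) = msmult c (\<Phi> X))"

definition block_psd :: "nat \<Rightarrow> nat \<Rightarrow> (nat \<Rightarrow> nat \<Rightarrow> 'a tmat) \<Rightarrow> bool" where
  "block_psd k n B \<longleftrightarrow> (\<forall>v :: nat \<Rightarrow> 'a list \<Rightarrow> complex.
     (let q = (\<Sum>i<n. \<Sum>j<n. \<Sum>x\<in>tuples k. \<Sum>y\<in>tuples k. cnj (v i x) * B i j x y * v j y)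
      in Im q = 0 \<and> Re q \<ge> 0))"

definition completely_positive :: "nat \<Rightarrow> ('a tmat \<Rightarrow> 'b tmat) \<Rightarrow> bool" where
  "completely_positive k \<Phi> \<longleftrightarrow> (\<forall>n (B :: nat \<Rightarrow> nat \<Rightarrow> 'a tmat).
     (\<forall>i j. B i j \<in> tspace k) \<longrightarrow> block_psd k n B \<longrightarrow> block_psd k n (\<lambda>i j. \<Phi> (B i j)))"

definition adjoint :: "nat \<Rightarrow> ('a tmat \<Rightarrow> 'b tmat) \<Rightarrow> 'b tmat \<Rightarrow> 'a tmat" where
  "adjoint k \<Phi> Y = (\<lambda>x y. if length x = k \<and> length y = k
      then tinner k (\<Phi> (munit x y)) Y else 0)"

definition level_qi_map ::
  "nat \<Rightarrow> ('a \<Rightarrow> 'a \<Rightarrow> bool) \<Rightarrow> ('b \<Rightarrow> 'b \<Rightarrow> bool) \<Rightarrow> ('a tmat \<Rightarrow> 'b tmat) \<Rightarrow> bool" where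
  "level_qi_map k G H \<Phi> \<longleftrightarrow>
     \<Phi> ` tspace k \<subseteq> tspace k \<and>
     lin_on k \<Phi> \<and>
     completely_positive k \<Phi> \<and>
     (\<forall>F\<in>QP k. \<forall>X\<in>tspace k. \<Phi> (mhad (hom_tensor G F) X) = mhad (hom_tensor H F) (\<Phi> X)) \<and>
     \<Phi> (mI k) = mI k \<and> adjoint k \<Phi> (mI k) = mI k \<and>
     \<Phi> (mJ k) = mJ k \<and> adjoint k \<Phi> (mJ k) = mJ k \<and>
     (\<forall>F\<in>Qk k. \<Phi> (hom_tensor G F) = hom_tensor H F) \<and>
     (\<forall>\<sigma>\<in>cyc_group k. \<forall>X\<in>tspace k. \<Phi> (pact k \<sigma> X) = pact k \<sigma> (\<Phi> X))"

inductive_set qalg :: "nat \<Rightarrow> ('a \<Rightarrow> 'a \<Rightarrow> bool) \<Rightarrow> 'a tmat set" for k adj where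
  I: "mI k \<in> qalg k adj"
| J: "mJ k \<in> qalg k adj"
| hom: "F \<in> Qk k \<Longrightarrow> hom_tensor adj F \<in> qalg k adj"
| zero: "mzero \<in> qalg k adj"
| add: "A \<in> qalg k adj \<Longrightarrow> B \<in> qalg k adj \<Longrightarrow> madd A B \<in> qalg k adj"
| smult: "A \<in> qalg k adj \<Longrightarrow> msmult c A \<in> qalg k adj"
| mult: "A \<in> qalg k adj \<Longrightarrow> B \<in> qalg k adj \<Longrightarrow> mmult k A B \<in> qalg k adj"
| ctrans: "A \<in> qalg k adj \<Longrightarrow> mctrans A \<in> qalg k adj"
| had: "F \<in> QP k \<Longrightarrow> A \<in> qalg k adj \<Longrightarrow> mhad (hom_tensor adj F) A \<in> qalg k adj"
| perm: "\<sigma> \<in> cyc_group k \<Longrightarrow> A \<in> qalg k adj \<Longrightarrow> pact k \<sigma> A \<in> qalg k adj"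

definition alg_equiv :: "nat \<Rightarrow> ('a \<Rightarrow> 'a \<Rightarrow> bool) \<Rightarrow> ('b \<Rightarrow> 'b \<Rightarrow> bool) \<Rightarrow> bool" where
  "alg_equiv k G H \<longleftrightarrow> (\<exists>\<phi> :: 'a tmat \<Rightarrow> 'b tmat.
     bij_betw \<phi> (qalg k G) (qalg k H) \<and>
     (\<forall>M\<in>qalg k G. \<forall>N\<in>qalg k G. \<forall>c.
        \<phi> (madd M N) = madd (\<phi> M) (\<phi> N) \<and> \<phi> (msmult c M) = msmult c (\<phi> M)) \<and>
     (\<forall>M\<in>qalg k G. \<phi> (mctrans M) = mctrans (\<phi> M)) \<and>
     (\<forall>M\<in>qalg k G. \<forall>N\<in>qalg k G. \<phi> (mmult k M N) = mmult k (\<phi> M) (\<phi> N)) \<and>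
     (\<forall>F\<in>QP k. \<forall>M\<in>qalg k G. \<phi> (mhad (hom_tensor G F) M) = mhad (hom_tensor H F) (\<phi> M)) \<and>
     \<phi> (mI k) = mI k \<and> \<phi> (mJ k) = mJ k \<and>
     (\<forall>F\<in>Qk k. \<phi> (hom_tensor G F) = hom_tensor H F) \<and>
     (\<forall>\<sigma>\<in>cyc_group k. \<forall>M\<in>qalg k G. \<phi> (pact k \<sigma> M) = pact k \<sigma> (\<phi> M)) \<and>
     (\<forall>M\<in>qalg k G. mtrace k (\<phi> M) = mtrace k M))"

end

theory Submission
  imports Defs "HOL-Combinatorics.Cycles" "HOL-Computational_Algebra.Fundamental_Theorem_Algebra"
    "HOL-Library.Complex_Order" "HOL-Library.Function_Algebras"
begin

text \<open>
  From an equivalence \<open>\<phi>\<close> one gets a map \<open>\<Phi> = \<phi> \<circ> E\<close>, where \<open>E\<close> is the orthogonal projection onto the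
  algebra of \<open>G\<close>. In an algebra of matrices closed under adjoints, a Hermitian \<open>Z\<close> whose trace pairings
  with all \<open>C C\<^sup>*\<close>, \<open>C\<close> in the algebra, are non-negative has the form \<open>C\<^sup>* C\<close>. These pairings are the
  same for \<open>X\<close> and for \<open>E(X)\<close>, so \<open>E\<close> sends positive matrices to matrices \<open>C\<^sup>* C\<close> with \<open>C\<close> in the
  algebra, and \<open>\<phi>\<close> keeps that form. Applied to block matrices this is complete positivity of \<open>\<Phi>\<close>.

  Conversely, let \<open>\<Phi>\<close> be a quantum isomorphism map. If \<open>\<Phi>\<close> preserves the norm of \<open>X\<close>, then the Schwarz
  defect \<open>\<Phi>(X\<^sup>* X) - \<Phi>(X)\<^sup>* \<Phi>(X) \<ge> 0\<close> has trace zero and so vanishes, and then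
  \<open>\<Phi>(A X) = \<Phi>(A) \<Phi>(X)\<close> for every \<open>A\<close>. The set of such \<open>X\<close> is an algebra with all the required
  closure properties, so it contains the algebra of \<open>G\<close>, on which \<open>\<Phi>\<close> is therefore an equivalence.
\<close>

section \<open>Matrices over a finite index set\<close>

type_synonym 'i cmat = "'i \<Rightarrow> 'i \<Rightarrow> complex"

definition mat_space :: "'i set \<Rightarrow> 'i cmat set" where
  "mat_space S = {A. \<forall>x y. x \<notin> S \<or> y \<notin> S \<longrightarrow> A x y = 0}"

definition mat_scale :: "complex \<Rightarrow> 'i cmat \<Rightarrow> 'i cmat" where
  "mat_scale c A = (\<lambda>x y. c * A x y)"

definition mat_id :: "'i set \<Rightarrow> 'i cmat" where
  "mat_id S = (\<lambda>x y. if x \<in> S \<and> x = y then 1 else 0)"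

definition mat_unit :: "'i \<Rightarrow> 'i \<Rightarrow> 'i cmat" where
  "mat_unit x y = (\<lambda>a b. if a = x \<and> b = y then 1 else 0)"

definition mat_mult :: "'i set \<Rightarrow> 'i cmat \<Rightarrow> 'i cmat \<Rightarrow> 'i cmat" where
  "mat_mult S A B = (\<lambda>x y. \<Sum>z\<in>S. A x z * B z y)"

definition mat_adj :: "'i cmat \<Rightarrow> 'i cmat" where
  "mat_adj A = (\<lambda>x y. cnj (A y x))"

definition mat_inner :: "'i set \<Rightarrow> 'i cmat \<Rightarrow> 'i cmat \<Rightarrow> complex" where
  "mat_inner S A B = (\<Sum>x\<in>S. \<Sum>y\<in>S. cnj (A x y) * B x y)"

text \<open>As simplification rules the pointwise equations would eta-expand unapplied matrices.\<close>
declare plus_fun_apply [simp del] zero_fun_apply [simp del] minus_apply [simp del]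

lemmas mat_apply = plus_fun_apply zero_fun_apply minus_apply mat_scale_def

interpretation mat: vector_space mat_scale
  by unfold_locales (auto simp: mat_apply fun_eq_iff algebra_simps)

lemma mat_sum_apply: "(\<Sum>l\<in>L. M l) x y = (\<Sum>l\<in>L. M l x y :: complex)"
  by (induction L rule: infinite_finite_induct) (auto simp: mat_apply)

lemma mat_eqI:
  assumes "A \<in> mat_space S" "B \<in> mat_space S"
    and "\<And>x y. x \<in> S \<Longrightarrow> y \<in> S \<Longrightarrow> A x y = B x y"
  shows "A = B"
proof (intro ext)
  fix x y show "A x y = B x y"
    using assms by (cases "x \<in> S \<and> y \<in> S") (auto simp: mat_space_def)
qed

lemma mat_subspace_mat_space: "mat.subspace (mat_space S)"
  by (auto simp: mat.subspace_def mat_space_def mat_apply)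

lemma mat_id_in_space: "mat_id S \<in> mat_space S"
  by (auto simp: mat_space_def mat_id_def)

lemma mat_unit_in_space: "x \<in> S \<Longrightarrow> y \<in> S \<Longrightarrow> mat_unit x y \<in> mat_space S"
  by (auto simp: mat_space_def mat_unit_def)

lemma mat_mult_in_space: "A \<in> mat_space S \<Longrightarrow> B \<in> mat_space S \<Longrightarrow> mat_mult S A B \<in> mat_space S"
  by (auto simp: mat_space_def mat_mult_def intro!: sum.neutral)

lemma mat_adj_in_space: "A \<in> mat_space S \<Longrightarrow> mat_adj A \<in> mat_space S"
  by (auto simp: mat_space_def mat_adj_def)

lemmas mat_space_intros = mat_id_in_space mat_mult_in_space mat_adj_in_space
  mat.subspace_0[OF mat_subspace_mat_space] mat.subspace_add[OF mat_subspace_mat_space]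
  mat.subspace_diff[OF mat_subspace_mat_space] mat.subspace_scale[OF mat_subspace_mat_space]

lemma mat_mult_assoc: "mat_mult S (mat_mult S A B) C = mat_mult S A (mat_mult S B C)"
proof (intro ext)
  fix x y
  have "mat_mult S (mat_mult S A B) C x y = (\<Sum>z\<in>S. \<Sum>w\<in>S. A x w * B w z * C z y)"
    by (simp add: mat_mult_def sum_distrib_right)
  also have "\<dots> = (\<Sum>w\<in>S. \<Sum>z\<in>S. A x w * B w z * C z y)"
    by (rule sum.swap)
  also have "\<dots> = mat_mult S A (mat_mult S B C) x y"
    by (simp add: mat_mult_def sum_distrib_left mult.assoc)
  finally show "mat_mult S (mat_mult S A B) C x y = mat_mult S A (mat_mult S B C) x y" .
qed

lemma mat_mult_zero_left [simp]: "mat_mult S 0 A = 0"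
  and mat_mult_zero_right [simp]: "mat_mult S A 0 = 0"
  by (simp_all add: mat_mult_def mat_apply fun_eq_iff)

lemma mat_mult_add_left: "mat_mult S (A + B) C = mat_mult S A C + mat_mult S B C"
  and mat_mult_add_right: "mat_mult S A (B + C) = mat_mult S A B + mat_mult S A C"
  by (simp_all add: mat_mult_def mat_apply fun_eq_iff algebra_simps sum.distrib)

lemma mat_mult_scale_left: "mat_mult S (mat_scale c A) B = mat_scale c (mat_mult S A B)"
  and mat_mult_scale_right: "mat_mult S A (mat_scale c B) = mat_scale c (mat_mult S A B)"
  by (simp_all add: mat_mult_def mat_apply fun_eq_iff algebra_simps sum_distrib_left)

lemma mat_adj_adj [simp]: "mat_adj (mat_adj A) = A"
  and mat_adj_zero [simp]: "mat_adj 0 = 0"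
  and mat_adj_id [simp]: "mat_adj (mat_id S) = mat_id S"
  and mat_adj_add: "mat_adj (A + B) = mat_adj A + mat_adj B"
  and mat_adj_diff: "mat_adj (A - B) = mat_adj A - mat_adj B"
  and mat_adj_scale: "mat_adj (mat_scale c A) = mat_scale (cnj c) (mat_adj A)"
  and mat_adj_mult: "mat_adj (mat_mult S A B) = mat_mult S (mat_adj B) (mat_adj A)"
  by (auto simp: mat_adj_def mat_id_def mat_mult_def mat_apply fun_eq_iff mult.commute)

lemma mat_mult_id_left:
  assumes "finite S" "A \<in> mat_space S"
  shows "mat_mult S (mat_id S) A = A"
proof (rule mat_eqI)
  fix x y assume "x \<in> S"
  then have "mat_mult S (mat_id S) A x y = (\<Sum>z\<in>S. if x = z then A z y else 0)"
    unfolding mat_mult_def mat_id_def by (intro sum.cong) auto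
  then show "mat_mult S (mat_id S) A x y = A x y"
    using \<open>x \<in> S\<close> assms(1) by simp
qed (use assms in \<open>auto intro: mat_space_intros\<close>)

lemma mat_mult_id_right:
  assumes "finite S" "A \<in> mat_space S"
  shows "mat_mult S A (mat_id S) = A"
  using mat_mult_id_left[OF assms(1) mat_adj_in_space[OF assms(2)]]
  by (metis mat_adj_adj mat_adj_id mat_adj_mult)

lemma cnj_mat_inner: "cnj (mat_inner S A B) = mat_inner S B A"
  by (simp add: mat_inner_def mult.commute)

lemma mat_inner_zero [simp]: "mat_inner S 0 A = 0" "mat_inner S A 0 = 0"
  by (simp_all add: mat_inner_def mat_apply)

lemma mat_inner_left:
  shows mat_inner_add_left: "mat_inner S (A + B) C = mat_inner S A C + mat_inner S B C"
    and mat_inner_diff_left: "mat_inner S (A - B) C = mat_inner S A C - mat_inner S B C"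
    and mat_inner_scale_left: "mat_inner S (mat_scale c A) C = cnj c * mat_inner S A C"
  by (simp_all add: mat_inner_def mat_apply algebra_simps sum.distrib sum_subtractf sum_distrib_left)

lemma mat_inner_right:
  shows mat_inner_add_right: "mat_inner S A (B + C) = mat_inner S A B + mat_inner S A C"
    and mat_inner_diff_right: "mat_inner S A (B - C) = mat_inner S A B - mat_inner S A C"
    and mat_inner_scale_right: "mat_inner S A (mat_scale c B) = c * mat_inner S A B"
  by (simp_all add: mat_inner_def mat_apply algebra_simps sum.distrib sum_subtractf sum_distrib_left)

lemma mat_inner_adj: "mat_inner S (mat_adj A) (mat_adj B) = mat_inner S B A"
  unfolding mat_inner_def mat_adj_def by (subst sum.swap) (simp add: mult.commute)

lemma mat_inner_mult_left:
  "mat_inner S (mat_mult S A B) C = mat_inner S B (mat_mult S (mat_adj A) C)"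
proof -
  let ?f = "\<lambda>x y z. cnj (B z y) * (cnj (A x z) * C x y)"
  have "mat_inner S (mat_mult S A B) C = (\<Sum>x\<in>S. \<Sum>y\<in>S. \<Sum>z\<in>S. ?f x y z)"
    by (simp add: mat_inner_def mat_mult_def sum_distrib_right mult.assoc mult.left_commute)
  also have "\<dots> = (\<Sum>y\<in>S. \<Sum>x\<in>S. \<Sum>z\<in>S. ?f x y z)"
    by (rule sum.swap)
  also have "\<dots> = (\<Sum>y\<in>S. \<Sum>z\<in>S. \<Sum>x\<in>S. ?f x y z)"
    by (intro sum.cong refl sum.swap)
  also have "\<dots> = (\<Sum>z\<in>S. \<Sum>y\<in>S. \<Sum>x\<in>S. ?f x y z)"
    by (rule sum.swap)
  also have "\<dots> = mat_inner S B (mat_mult S (mat_adj A) C)"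
    by (simp add: mat_inner_def mat_mult_def mat_adj_def sum_distrib_left)
  finally show ?thesis .
qed

lemma mat_inner_mult_right:
  "mat_inner S A (mat_mult S B C) = mat_inner S (mat_mult S A (mat_adj C)) B"
proof -
  have "mat_inner S A (mat_mult S B C) = mat_inner S (mat_mult S (mat_adj C) (mat_adj B)) (mat_adj A)"
    by (simp add: mat_inner_adj[of S "mat_mult S B C" A, symmetric] mat_adj_mult)
  also have "\<dots> = mat_inner S (mat_adj B) (mat_mult S C (mat_adj A))"
    by (simp add: mat_inner_mult_left)
  also have "\<dots> = mat_inner S (mat_mult S A (mat_adj C)) B"
    using mat_inner_adj[of S B "mat_mult S A (mat_adj C)"] by (simp add: mat_adj_mult)
  finally show ?thesis .
qed

lemma mat_inner_unit_left:
  assumes "finite S" "x \<in> S" "y \<in> S"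
  shows "mat_inner S (mat_unit x y) A = A x y"
proof -
  have "mat_inner S (mat_unit x y) A = (\<Sum>a\<in>S. if a = x then \<Sum>b\<in>S. if b = y then A a b else 0 else 0)"
    unfolding mat_inner_def mat_unit_def by (intro sum.cong) (auto intro: sum.cong sum.neutral)
  then show ?thesis
    using assms by simp
qed

lemma mat_inner_id:
  assumes "finite S"
  shows "mat_inner S (mat_id S) A = (\<Sum>x\<in>S. A x x)"
  unfolding mat_inner_def
proof (intro sum.cong refl)
  fix x assume "x \<in> S"
  then have "(\<Sum>y\<in>S. cnj (mat_id S x y) * A x y) = (\<Sum>y\<in>S. if x = y then A x y else 0)"
    by (intro sum.cong) (auto simp: mat_id_def)
  then show "(\<Sum>y\<in>S. cnj (mat_id S x y) * A x y) = A x x"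
    using \<open>x \<in> S\<close> assms by simp
qed

lemma mat_inner_eq_trace:
  assumes "finite S" "A \<in> mat_space S"
  shows "mat_inner S A B = mat_inner S (mat_id S) (mat_mult S (mat_adj A) B)"
  using mat_inner_mult_left[of S A "mat_id S" B] by (simp add: mat_mult_id_right assms)

lemma cnj_mult_self_nonneg: "0 \<le> cnj z * z"
  by (simp add: less_eq_complex_def)

lemma mat_inner_self_nonneg: "0 \<le> mat_inner S A A"
  unfolding mat_inner_def by (intro sum_nonneg cnj_mult_self_nonneg)

lemma mat_inner_self_eq_0_iff:
  assumes "finite S" "A \<in> mat_space S"
  shows "mat_inner S A A = 0 \<longleftrightarrow> A = 0"
proof
  assume "mat_inner S A A = 0"
  then have "\<forall>x\<in>S. \<forall>y\<in>S. cnj (A x y) * A x y = 0"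
    unfolding mat_inner_def using assms(1)
    by (simp add: sum_nonneg_eq_0_iff sum_nonneg cnj_mult_self_nonneg)
  then show "A = 0"
    by (intro mat_eqI[OF assms(2)]) (auto simp: mat_apply intro: mat_space_intros)
qed simp

lemma mat_space_eq_span_units:
  assumes "finite S"
  shows "mat_space S = mat.span ((\<lambda>(x, y). mat_unit x y) ` (S \<times> S))"
proof
  let ?U = "(\<lambda>(x, y). mat_unit x y) ` (S \<times> S)"
  show "mat.span ?U \<subseteq> mat_space S"
    by (intro mat.span_minimal mat_subspace_mat_space) (auto intro: mat_unit_in_space)
  show "mat_space S \<subseteq> mat.span ?U"
  proof
    fix A assume A: "A \<in> mat_space S"
    let ?B = "\<Sum>p\<in>S \<times> S. mat_scale (A (fst p) (snd p)) (mat_unit (fst p) (snd p))"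
    have "A = ?B"
    proof (rule mat_eqI[OF A])
      show "?B \<in> mat_space S"
        by (intro mat.subspace_sum[OF mat_subspace_mat_space] mat_space_intros mat_unit_in_space) auto
      fix x y assume xy: "x \<in> S" "y \<in> S"
      have "?B x y = (\<Sum>p\<in>S \<times> S. if p = (x, y) then A x y else 0)"
        unfolding mat_sum_apply by (intro sum.cong) (auto simp: mat_unit_def mat_apply)
      then show "A x y = ?B x y"
        using xy assms by simp
    qed
    also have "\<dots> \<in> mat.span ?U"
      by (intro mat.span_sum mat.span_scale mat.span_base) auto
    finally show "A \<in> mat.span ?U" .
  qed
qed

lemma mat_subspace_finite_span:
  assumes "finite S" "mat.subspace W" "W \<subseteq> mat_space S"
  obtains B where "finite B" "W = mat.span B"
proof -
  obtain B where B: "B \<subseteq> W" "mat.independent B" "W \<subseteq> mat.span B"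
    by (rule mat.maximal_independent_subset)
  have "finite B"
    using B(1) assms(3) mat.independent_span_bound[OF _ B(2)]
    unfolding mat_space_eq_span_units[OF assms(1)]
    by (metis assms(1) finite_SigmaI finite_imageI order_trans)
  moreover have "W = mat.span B"
    using B(1,3) assms(2) by (simp add: mat.span_minimal subset_antisym)
  ultimately show thesis
    by (rule that)
qed

section \<open>Orthogonal projections\<close>

lemma mat_span_insert_decomp:
  assumes "A \<in> mat.span (insert b B)" "c \<in> mat.span B"
  shows "\<exists>t. A - mat_scale t (b - c) \<in> mat.span B"
proof -
  obtain t where "A - mat_scale t b \<in> mat.span B"
    using assms(1) by (auto simp: mat.span_breakdown_eq)
  then have "A - mat_scale t b + mat_scale t c \<in> mat.span B"
    using assms(2) by (intro mat.span_add mat.span_scale)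
  then show ?thesis
    by (intro exI[of _ t]) (simp add: algebra_simps)
qed

lemma orthogonal_projection_extend:
  assumes S: "finite S" and d: "d \<in> mat_space S" "\<And>A. A \<in> W \<Longrightarrow> mat_inner S A d = 0"
    and Y: "Y \<in> W" "\<And>A. A \<in> W \<Longrightarrow> mat_inner S A Y = mat_inner S A X"
    and A: "A - mat_scale t d \<in> W"
  defines "Y' \<equiv> Y + mat_scale (mat_inner S d X / mat_inner S d d) d"
  shows "mat_inner S A Y' = mat_inner S A X"
proof -
  have "mat_inner S d Y = 0"
    using d(2)[OF Y(1)] by (metis cnj_mat_inner complex_cnj_zero)
  then have "mat_inner S d Y' = mat_inner S d X"
    using mat_inner_self_eq_0_iff[OF S d(1)] by (auto simp: Y'_def mat_inner_right)
  moreover have "mat_inner S (A - mat_scale t d) Y' = mat_inner S (A - mat_scale t d) X"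
    using Y(2)[OF A] d(2)[OF A] unfolding Y'_def mat_inner_right by simp
  ultimately show ?thesis
    by (simp add: mat_inner_left)
qed

lemma mat_span_orthogonal_projection:
  assumes "finite S" "finite B" "B \<subseteq> mat_space S"
  shows "\<exists>Y\<in>mat.span B. \<forall>A\<in>mat.span B. mat_inner S A Y = mat_inner S A X"
  using assms(2,3)
proof (induction B arbitrary: X rule: finite_induct)
  case empty
  then show ?case by simp
next
  case (insert b B)
  let ?W = "mat.span B" and ?W' = "mat.span (insert b B)"
  have sub: "?W \<subseteq> ?W'"
    by (intro mat.span_mono) auto
  obtain c where c: "c \<in> ?W" "\<And>A. A \<in> ?W \<Longrightarrow> mat_inner S A c = mat_inner S A b"
    using insert by blast
  define d where "d = b - c"
  have "c \<in> mat_space S"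
    using c(1) insert.prems mat.span_minimal[OF _ mat_subspace_mat_space, of B S] by auto
  then have d: "d \<in> mat_space S" "\<And>A. A \<in> ?W \<Longrightarrow> mat_inner S A d = 0"
    using c(2) insert.prems by (auto simp: d_def mat_inner_right intro: mat_space_intros)
  obtain Y where Y: "Y \<in> ?W" "\<And>A. A \<in> ?W \<Longrightarrow> mat_inner S A Y = mat_inner S A X"
    using insert by blast
  define Y' where "Y' = Y + mat_scale (mat_inner S d X / mat_inner S d d) d"
  have "mat_inner S A Y' = mat_inner S A X" if "A \<in> ?W'" for A
    using mat_span_insert_decomp[OF that c(1)] orthogonal_projection_extend[OF assms(1) d Y]
    by (auto simp: Y'_def d_def)
  moreover have "d \<in> ?W'"
    unfolding d_def using c(1) sub by (intro mat.span_diff) (auto intro: mat.span_base)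
  then have "Y' \<in> ?W'"
    unfolding Y'_def using Y(1) sub by (intro mat.span_add mat.span_scale) auto
  ultimately show ?case
    by blast
qed

locale mat_subspace =
  fixes S :: "'i set" and W :: "'i cmat set"
  assumes finite_index: "finite S"
    and subset_space: "W \<subseteq> mat_space S"
    and subspace: "mat.subspace W"
begin

lemmas zero_in = mat.subspace_0[OF subspace]
  and add_in = mat.subspace_add[OF subspace]
  and diff_in = mat.subspace_diff[OF subspace]
  and scale_in = mat.subspace_scale[OF subspace]
  and sum_in = mat.subspace_sum[OF subspace]

definition proj :: "'i cmat \<Rightarrow> 'i cmat" where
  "proj X = (SOME Y. Y \<in> W \<and> (\<forall>A\<in>W. mat_inner S A Y = mat_inner S A X))"

lemma proj_in: "proj X \<in> W"
  and mat_inner_proj: "A \<in> W \<Longrightarrow> mat_inner S A (proj X) = mat_inner S A X"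
proof -
  obtain B where B: "finite B" "W = mat.span B"
    using mat_subspace_finite_span[OF finite_index subspace subset_space] .
  have "\<exists>Y. Y \<in> W \<and> (\<forall>A\<in>W. mat_inner S A Y = mat_inner S A X)"
    using mat_span_orthogonal_projection[OF finite_index B(1)] mat.span_superset[of B] subset_space B(2)
    by blast
  from someI_ex[OF this] show "proj X \<in> W" "A \<in> W \<Longrightarrow> mat_inner S A (proj X) = mat_inner S A X"
    by (auto simp: proj_def)
qed

lemma mat_inner_proj_left: "A \<in> W \<Longrightarrow> mat_inner S (proj X) A = mat_inner S X A"
  by (metis cnj_mat_inner mat_inner_proj)

lemma proj_eqI:
  assumes "Y \<in> W" "\<And>A. A \<in> W \<Longrightarrow> mat_inner S A X = mat_inner S A Y"
  shows "proj X = Y"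
proof -
  have "proj X - Y \<in> W"
    by (intro diff_in proj_in assms(1))
  moreover have "mat_inner S A (proj X - Y) = 0" if "A \<in> W" for A
    using that assms(2) by (simp add: mat_inner_right mat_inner_proj)
  ultimately have "proj X - Y = 0"
    using mat_inner_self_eq_0_iff[OF finite_index] subset_space by blast
  then show ?thesis
    by simp
qed

lemma proj_id: "A \<in> W \<Longrightarrow> proj A = A"
  by (rule proj_eqI) auto

lemma proj_add: "proj (X + Y) = proj X + proj Y"
  by (rule proj_eqI) (simp_all add: proj_in mat_inner_proj mat_inner_right add_in)

lemma proj_scale: "proj (mat_scale c X) = mat_scale c (proj X)"
  by (rule proj_eqI) (simp_all add: proj_in mat_inner_proj mat_inner_right scale_in)

lemma proj_commute:
  assumes "\<And>A. A \<in> W \<Longrightarrow> T A \<in> W" "\<And>A. A \<in> W \<Longrightarrow> T' A \<in> W"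
    and "\<And>A X. A \<in> W \<Longrightarrow> mat_inner S A (T X) = mat_inner S (T' A) X"
  shows "proj (T X) = T (proj X)"
  by (rule proj_eqI) (simp_all add: assms proj_in mat_inner_proj)

end

section \<open>Polynomials in a matrix\<close>

definition mat_poly :: "'i set \<Rightarrow> 'i cmat \<Rightarrow> complex poly \<Rightarrow> 'i cmat" where
  "mat_poly S A p = fold_coeffs (\<lambda>a B. mat_scale a (mat_id S) + mat_mult S A B) p 0"

lemma mat_poly_0 [simp]: "mat_poly S A 0 = 0"
  by (simp add: mat_poly_def)

lemma mat_poly_pCons [simp]:
  "mat_poly S A (pCons a p) = mat_scale a (mat_id S) + mat_mult S A (mat_poly S A p)"
  by (cases "p = 0 \<and> a = 0") (auto simp: mat_poly_def)

lemma mat_poly_add: "mat_poly S A (p + q) = mat_poly S A p + mat_poly S A q"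
  by (induction p q rule: poly_induct2) (simp_all add: mat_mult_add_right mat.scale_left_distrib)

lemma mat_poly_diff: "mat_poly S A (p - q) = mat_poly S A p - mat_poly S A q"
  using mat_poly_add[of S A "p - q" q] by simp

lemma mat_poly_smult: "mat_poly S A (smult c p) = mat_scale c (mat_poly S A p)"
  by (induction p) (simp_all add: mat_mult_scale_right mat.scale_right_distrib)

context
  fixes S :: "'i set" and A :: "'i cmat"
  assumes fin: "finite S" and A: "A \<in> mat_space S"
begin

lemma mat_poly_in_space: "mat_poly S A p \<in> mat_space S"
  by (induction p) (auto intro: mat_space_intros A)

lemma mat_poly_mult: "mat_poly S A (p * q) = mat_mult S (mat_poly S A p) (mat_poly S A q)"
  by (induction p)
    (simp_all add: mat_poly_add mat_poly_smult mat_mult_add_left mat_mult_scale_left mat_mult_assoc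
      mat_mult_id_left fin mat_poly_in_space)

lemma mat_poly_X: "mat_poly S A [:0, 1:] = A"
  by (simp add: mat_mult_id_right fin A)

lemma mat_poly_commute: "mat_mult S A (mat_poly S A p) = mat_mult S (mat_poly S A p) A"
  using mat_poly_mult[of p "[:0, 1:]"] mat_poly_mult[of "[:0, 1:]" p]
  by (simp only: mult.commute mat_poly_X)

lemma mat_adj_mat_poly:
  assumes "mat_adj A = A"
  shows "mat_adj (mat_poly S A p) = mat_poly S A (map_poly cnj p)"
  by (induction p)
    (simp_all add: map_poly_pCons mat_adj_add mat_adj_scale mat_adj_mult assms mat_poly_commute)

lemma hermitian_mat_poly_power_eq_0:
  assumes herm: "mat_adj (mat_poly S A p) = mat_poly S A p" and "mat_poly S A (p ^ n) = 0"
  shows "mat_poly S A p = 0"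
  using assms(2)
proof (induction n)
  case 0
  then show ?case
    using mat_poly_mult[of 1 p] by simp
next
  case (Suc n)
  show ?case
  proof (cases n)
    case (Suc m)
    have "mat_inner S (mat_poly S A (p ^ n)) (mat_poly S A (p ^ n))
        = mat_inner S (mat_poly S A (p ^ m)) (mat_poly S A (p ^ Suc n))"
      unfolding \<open>n = Suc m\<close> power_Suc mat_poly_mult by (simp add: mat_inner_mult_left herm)
    then have "mat_poly S A (p ^ n) = 0"
      using Suc.prems mat_inner_self_eq_0_iff[OF fin mat_poly_in_space] by simp
    then show ?thesis
      by (rule Suc.IH)
  qed (use Suc.prems in simp)
qed

end

lemma exists_poly_in_kernels:
  fixes f :: "'t \<Rightarrow> 'a::field poly \<Rightarrow> 'a"
  assumes "finite T" and "\<And>t p q. t \<in> T \<Longrightarrow> f t (p + q) = f t p + f t q"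
    and "\<And>t c p. t \<in> T \<Longrightarrow> f t (smult c p) = c * f t p"
  shows "\<exists>p. p \<noteq> 0 \<and> (\<forall>t\<in>T. f t p = 0)"
  using assms
proof (induction T arbitrary: f rule: finite_induct)
  case empty
  then show ?case by (intro exI[of _ 1]) simp
next
  case (insert s T)
  have "\<exists>p. p \<noteq> 0 \<and> (\<forall>t\<in>T. f t p = 0)"
    using insert.prems by (intro insert.IH) simp_all
  then obtain p where p: "p \<noteq> 0" "\<forall>t\<in>T. f t p = 0"
    by blast
  \<comment> \<open>The factor \<open>x\<close> makes the second candidate linearly independent of the first.\<close>
  define x where "x = (monom 1 (Suc (degree p)) :: 'a poly)"
  have "\<exists>q. q \<noteq> 0 \<and> (\<forall>t\<in>T. f t (x * q) = 0)"
    using insert.prems by (intro insert.IH) (simp_all add: distrib_left)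
  then obtain q where q: "q \<noteq> 0" "\<forall>t\<in>T. f t (x * q) = 0"
    by blast
  show ?case
  proof (cases "f s p = 0")
    case False
    define r where "r = x * q + smult (- (f s (x * q) / f s p)) p"
    have less: "degree p < degree (x * q)"
      using q(1) by (simp add: x_def degree_mult_eq degree_monom_eq)
    then have "degree r = degree (x * q)"
      unfolding r_def by (intro degree_add_eq_left) (rule le_less_trans[OF degree_smult_le])
    then have "r \<noteq> 0"
      using less by auto
    moreover have "\<forall>t\<in>insert s T. f t r = 0"
      using p(2) q(2) False insert.prems by (auto simp: r_def simp del: smult_minus_left)
    ultimately show ?thesis
      by blast
  qed (use p in auto)
qed

lemma exists_annihilating_poly:
  assumes "finite S" "A \<in> mat_space S"
  shows "\<exists>p. p \<noteq> 0 \<and> mat_poly S A p = 0"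
proof -
  obtain p where p: "p \<noteq> 0" "\<forall>t\<in>S \<times> S. mat_poly S A p (fst t) (snd t) = 0"
    using exists_poly_in_kernels[of "S \<times> S" "\<lambda>t p. mat_poly S A p (fst t) (snd t)"] assms(1)
    by (auto simp: mat_poly_add mat_poly_smult mat_apply)
  then have "mat_poly S A p = 0"
    by (intro mat_eqI[OF mat_poly_in_space[OF assms]]) (auto simp: mat_apply intro: mat_space_intros)
  with p(1) show ?thesis
    by blast
qed

lemma exists_interpolating_poly:
  fixes f :: "'a::field \<Rightarrow> 'a"
  assumes "finite R"
  shows "\<exists>p. \<forall>r\<in>R. poly p r = f r"
  using assms
proof (induction R rule: finite_induct)
  case (insert a R)
  obtain p where p: "\<forall>r\<in>R. poly p r = f r"
    using insert.IH by blast
  define q where "q = (\<Prod>r\<in>R. [:- r, 1:])"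
  have "poly q a \<noteq> 0" "\<forall>r\<in>R. poly q r = 0"
    using insert.hyps by (auto simp: q_def poly_prod)
  then have "\<forall>r\<in>insert a R. poly (p + smult ((f a - poly p a) / poly q a) q) r = f r"
    using p by simp
  then show ?case
    by blast
qed simp

section \<open>Algebras of matrices closed under adjoints\<close>

locale star_algebra = mat_subspace S W for S :: "'i set" and W +
  assumes id_in: "mat_id S \<in> W"
    and mult_in: "A \<in> W \<Longrightarrow> B \<in> W \<Longrightarrow> mat_mult S A B \<in> W"
    and adj_in: "A \<in> W \<Longrightarrow> mat_adj A \<in> W"
begin

lemma proj_adj: "proj (mat_adj X) = mat_adj (proj X)"
proof (rule proj_eqI)
  fix A assume "A \<in> W"
  then show "mat_inner S A (mat_adj X) = mat_inner S A (mat_adj (proj X))"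
    using mat_inner_adj[of S "mat_adj A"] by (simp add: mat_inner_proj_left adj_in)
qed (simp add: proj_in adj_in)

lemma mat_poly_in: "A \<in> W \<Longrightarrow> mat_poly S A p \<in> W"
  by (induction p)
    (auto intro: zero_in add_in scale_in mult_in id_in)

lemma minimal_poly_root_nonneg:
  assumes Z: "Z \<in> W" and pos: "\<And>C. C \<in> W \<Longrightarrow> 0 \<le> mat_inner S C (mat_mult S Z C)"
    and p: "p \<noteq> 0" "mat_poly S Z p = 0"
    and minimal: "\<And>q. q \<noteq> 0 \<Longrightarrow> mat_poly S Z q = 0 \<Longrightarrow> degree p \<le> degree q"
    and root: "poly p r = 0"
  shows "0 \<le> r"
proof -
  obtain q where q: "p = [:- r, 1:] * q"
    using root by (auto simp: poly_eq_0_iff_dvd)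
  define Q where "Q = mat_poly S Z q"
  have "q \<noteq> 0" "degree q < degree p"
    using p(1) by (auto simp: q degree_mult_eq simp del: mult_pCons_left)
  then have "Q \<noteq> 0"
    using minimal[of q] by (auto simp: Q_def)
  then have "mat_inner S Q Q \<noteq> 0"
    using mat_inner_self_eq_0_iff[OF finite_index] mat_poly_in[OF Z] subset_space
    unfolding Q_def by blast
  then have "0 < mat_inner S Q Q"
    by (simp add: order.strict_iff_order mat_inner_self_nonneg)
  moreover have "mat_mult S Z Q = mat_scale r Q"
    using p(2) by (simp add: q Q_def mat_poly_diff mat_poly_smult)
  then have "0 \<le> r * mat_inner S Q Q"
    using pos[of Q] mat_poly_in[OF Z] by (simp add: Q_def mat_inner_right)
  ultimately show ?thesis
    by (auto simp: less_eq_complex_def less_complex_def zero_le_mult_iff)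
qed

text \<open>The square root is a polynomial in \<open>Z\<close> interpolating the square root at the zeros of the
  minimal polynomial; by the Nullstellensatz its defect is nilpotent, hence zero.\<close>
theorem hermitian_imp_square:
  assumes Z: "Z \<in> W" and herm: "mat_adj Z = Z"
    and pos: "\<And>C. C \<in> W \<Longrightarrow> 0 \<le> mat_inner S C (mat_mult S Z C)"
  shows "\<exists>C\<in>W. Z = mat_mult S (mat_adj C) C"
proof -
  have Z': "Z \<in> mat_space S"
    using Z subset_space by blast
  note poly_simps = mat_poly_diff mat_poly_mult[OF finite_index Z'] mat_poly_X[OF finite_index Z']
    mat_adj_mat_poly[OF finite_index Z' herm]
  obtain p where p: "p \<noteq> 0" "mat_poly S Z p = 0"
    and minimal: "\<And>q. q \<noteq> 0 \<Longrightarrow> mat_poly S Z q = 0 \<Longrightarrow> degree p \<le> degree q"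
    using ex_has_least_nat[of "\<lambda>p. p \<noteq> 0 \<and> mat_poly S Z p = 0" _ degree]
      exists_annihilating_poly[OF finite_index Z'] by blast
  obtain s where s: "\<And>r. poly p r = 0 \<Longrightarrow> poly s r = csqrt r"
    using exists_interpolating_poly[OF poly_roots_finite[OF p(1)], of csqrt] by auto
  define C where "C = mat_poly S Z s"
  define h where "h = map_poly cnj s * s - [:0, 1:]"
  have h: "mat_poly S Z h = mat_mult S (mat_adj C) C - Z"
    unfolding h_def C_def poly_simps by simp
  have "poly h r = 0" if "poly p r = 0" for r
  proof -
    have "0 \<le> r"
      by (rule minimal_poly_root_nonneg[OF Z pos p minimal that])
    then have "cnj r = r" "cnj (csqrt r) * csqrt r = r"
      by (auto simp: less_eq_complex_def complex_eq_iff simp flip: power2_eq_square)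
    with s[OF that] show ?thesis
      by (simp add: h_def)
  qed
  then have "p dvd h ^ degree p"
    using nullstellensatz_univariate[of p h] p(1) by blast
  then have "mat_poly S Z (h ^ degree p) = 0"
    by (auto simp: poly_simps p(2))
  then have "mat_poly S Z h = 0"
    by (rule hermitian_mat_poly_power_eq_0[OF finite_index Z', rotated])
      (simp add: h mat_adj_diff mat_adj_mult herm)
  then have "Z = mat_mult S (mat_adj C) C"
    by (simp add: h)
  then show ?thesis
    using mat_poly_in[OF Z] by (auto simp: C_def)
qed

end

section \<open>Positive semidefinite matrices\<close>

definition mat_form :: "'i set \<Rightarrow> 'i cmat \<Rightarrow> ('i \<Rightarrow> complex) \<Rightarrow> ('i \<Rightarrow> complex) \<Rightarrow> complex" where
  "mat_form S Z u v = (\<Sum>x\<in>S. \<Sum>y\<in>S. cnj (u x) * Z x y * v y)"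

definition psd_on :: "'i set \<Rightarrow> 'i cmat \<Rightarrow> bool" where
  "psd_on S Z \<longleftrightarrow> (\<forall>v. 0 \<le> mat_form S Z v v)"

definition unit_vec :: "'i \<Rightarrow> 'i \<Rightarrow> complex" where
  "unit_vec x = (\<lambda>z. if z = x then 1 else 0)"

lemma mat_form_zero [simp]: "mat_form S Z (\<lambda>x. 0) v = 0" "mat_form S Z u (\<lambda>x. 0) = 0"
  by (simp_all add: mat_form_def)

lemma mat_form_uminus [simp]:
  "mat_form S Z (\<lambda>x. - u x) v = - mat_form S Z u v" "mat_form S Z u (\<lambda>x. - v x) = - mat_form S Z u v"
  by (simp_all add: mat_form_def sum_negf)

lemma mat_form_add_scaled:
  "mat_form S Z (\<lambda>x. u x + c * v x) (\<lambda>x. u x + c * v x)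
    = mat_form S Z u u + c * mat_form S Z u v + cnj c * mat_form S Z v u + cnj c * c * mat_form S Z v v"
  by (simp add: mat_form_def algebra_simps sum.distrib sum_distrib_left)

lemma sum_unit_vec:
  assumes "finite S" "x \<in> S"
  shows "(\<Sum>y\<in>S. f y * unit_vec x y) = f x" "(\<Sum>y\<in>S. cnj (unit_vec x y) * f y) = f x"
  using assms by (simp_all add: unit_vec_def if_distrib if_distribR cong: if_cong)

lemma mat_form_unit_left:
  assumes "finite S" "x \<in> S"
  shows "mat_form S Z (unit_vec x) v = (\<Sum>y\<in>S. Z x y * v y)"
  using sum_unit_vec(2)[OF assms, of "\<lambda>a. \<Sum>y\<in>S. Z a y * v y"]
  by (simp add: mat_form_def sum_distrib_left mult.assoc)

lemma mat_form_unit_right: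
  assumes "finite S" "y \<in> S"
  shows "mat_form S Z u (unit_vec y) = (\<Sum>x\<in>S. cnj (u x) * Z x y)"
  by (simp add: mat_form_def sum_unit_vec assms)

lemma mat_form_units:
  assumes "finite S" "x \<in> S" "y \<in> S"
  shows "mat_form S Z (unit_vec x) (unit_vec y) = Z x y"
  by (simp add: mat_form_unit_left sum_unit_vec assms)

lemma mat_form_id:
  assumes "finite S"
  shows "mat_form S (mat_id S) u v = (\<Sum>x\<in>S. cnj (u x) * v x)"
proof -
  have "mat_form S (mat_id S) u v = mat_inner S (mat_id S) (\<lambda>x y. cnj (u x) * v y)"
    by (simp add: mat_form_def mat_inner_def mat_id_def if_distrib if_distribR mult_ac cong: if_cong)
  then show ?thesis
    by (simp add: mat_inner_id assms)
qed

lemma psd_on_cong: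
  "(\<And>x y. x \<in> S \<Longrightarrow> y \<in> S \<Longrightarrow> A x y = B x y) \<Longrightarrow> psd_on S A \<longleftrightarrow> psd_on S B"
  by (simp add: psd_on_def mat_form_def cong: sum.cong)

lemma psd_on_gram: "psd_on S (\<lambda>x y. \<Sum>z\<in>T. cnj (D z x) * D z y)"
  unfolding psd_on_def
proof
  fix v
  have "mat_form S (\<lambda>x y. \<Sum>z\<in>T. cnj (D z x) * D z y) v v
      = (\<Sum>x\<in>S. \<Sum>y\<in>S. \<Sum>z\<in>T. cnj (D z x * v x) * (D z y * v y))"
    by (simp add: mat_form_def sum_distrib_left sum_distrib_right mult_ac)
  also have "\<dots> = (\<Sum>x\<in>S. \<Sum>z\<in>T. \<Sum>y\<in>S. cnj (D z x * v x) * (D z y * v y))"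
    by (intro sum.cong refl sum.swap)
  also have "\<dots> = (\<Sum>z\<in>T. \<Sum>x\<in>S. \<Sum>y\<in>S. cnj (D z x * v x) * (D z y * v y))"
    by (rule sum.swap)
  also have "\<dots> = (\<Sum>z\<in>T. cnj (\<Sum>x\<in>S. D z x * v x) * (\<Sum>x\<in>S. D z x * v x))"
    by (simp add: sum_product)
  also have "0 \<le> \<dots>"
    by (intro sum_nonneg cnj_mult_self_nonneg)
  finally show "0 \<le> mat_form S (\<lambda>x y. \<Sum>z\<in>T. cnj (D z x) * D z y) v v" .
qed

lemma psd_on_form_cnj:
  assumes "psd_on S Z"
  shows "cnj (mat_form S Z u v) = mat_form S Z v u"
proof -
  have "0 \<le> mat_form S Z u u + c * mat_form S Z u v + cnj c * mat_form S Z v u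
      + cnj c * c * mat_form S Z v v" for c
    using assms unfolding psd_on_def mat_form_add_scaled[symmetric] by blast
  from this[of 1] this[of \<i>] have "Im (mat_form S Z u v + mat_form S Z v u) = 0"
    "Re (mat_form S Z u v - mat_form S Z v u) = 0"
    using assms by (auto simp: psd_on_def less_eq_complex_def)
  then show ?thesis
    by (simp add: complex_eq_iff)
qed

lemma psd_on_hermitian:
  assumes "psd_on S Z" "finite S" "x \<in> S" "y \<in> S"
  shows "Z y x = cnj (Z x y)"
  using psd_on_form_cnj[OF assms(1), of "unit_vec x" "unit_vec y"] assms(2-)
  by (simp add: mat_form_units)

lemma psd_on_form_kernel:
  assumes psd: "psd_on S Z" and kernel: "mat_form S Z v v = 0"
  shows "mat_form S Z u v = 0"
proof (rule ccontr)
  define c where "c = mat_form S Z u v"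
  assume "mat_form S Z u v \<noteq> 0"
  then have pos: "(cmod c)\<^sup>2 > 0"
    by (simp add: c_def)
  have "0 \<le> Re (mat_form S Z u u) - 2 * t * (cmod c)\<^sup>2" for t :: real
  proof -
    let ?d = "- of_real t * cnj c"
    have "0 \<le> Re (mat_form S Z u u + ?d * mat_form S Z u v + cnj ?d * mat_form S Z v u
        + cnj ?d * ?d * mat_form S Z v v)"
      using psd unfolding psd_on_def mat_form_add_scaled[symmetric] less_eq_complex_def by auto
    also have "\<dots> = Re (mat_form S Z u u) - 2 * t * (cmod c)\<^sup>2"
      unfolding kernel psd_on_form_cnj[OF psd, of u v, symmetric] c_def[symmetric] cmod_power2
      by (simp add: algebra_simps power2_eq_square)
    finally show ?thesis .
  qed
  from this[of "(Re (mat_form S Z u u) + 1) / (2 * (cmod c)\<^sup>2)"] show False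
    using pos by simp
qed

lemma psd_on_inner_nonneg:
  assumes "psd_on S Z"
  shows "0 \<le> mat_inner S C (mat_mult S Z C)"
proof -
  have "mat_inner S C (mat_mult S Z C) = (\<Sum>x\<in>S. \<Sum>y\<in>S. \<Sum>z\<in>S. cnj (C x y) * Z x z * C z y)"
    by (simp add: mat_inner_def mat_mult_def sum_distrib_left mult.assoc)
  also have "\<dots> = (\<Sum>y\<in>S. mat_form S Z (\<lambda>x. C x y) (\<lambda>x. C x y))"
    unfolding mat_form_def by (rule sum.swap)
  also have "0 \<le> \<dots>"
    using assms by (intro sum_nonneg) (simp add: psd_on_def)
  finally show ?thesis .
qed

lemma (in star_algebra) proj_psd_eq_square:
  assumes "psd_on S X"
  shows "\<exists>C\<in>W. proj X = mat_mult S (mat_adj C) C"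
proof (rule hermitian_imp_square[OF proj_in])
  have "proj (mat_adj X) = proj X"
  proof (rule proj_eqI[OF proj_in])
    fix A assume "A \<in> W"
    have "mat_inner S A (mat_adj X) = mat_inner S A X"
      unfolding mat_inner_def mat_adj_def
      by (intro sum.cong refl) (simp flip: psd_on_hermitian[OF assms finite_index])
    then show "mat_inner S A (mat_adj X) = mat_inner S A (proj X)"
      using \<open>A \<in> W\<close> by (simp add: mat_inner_proj)
  qed
  then show "mat_adj (proj X) = proj X"
    by (simp add: proj_adj)
next
  fix C assume "C \<in> W"
  then have "mat_inner S C (mat_mult S (proj X) C) = mat_inner S C (mat_mult S X C)"
    by (simp add: mat_inner_mult_right mat_inner_proj mult_in adj_in)
  also have "0 \<le> \<dots>"
    by (rule psd_on_inner_nonneg[OF assms])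
  finally show "0 \<le> mat_inner S C (mat_mult S (proj X) C)" .
qed

section \<open>Block matrices and complete positivity\<close>

definition block_mat :: "('n \<Rightarrow> 'n \<Rightarrow> 'i cmat) \<Rightarrow> ('n \<times> 'i) cmat" where
  "block_mat B = (\<lambda>(i, x) (j, y). B i j x y)"

definition block :: "('n \<times> 'i) cmat \<Rightarrow> 'n \<Rightarrow> 'n \<Rightarrow> 'i cmat" where
  "block A i j = (\<lambda>x y. A (i, x) (j, y))"

lemma block_mat_apply [simp]: "block_mat B (i, x) (j, y) = B i j x y"
  by (simp add: block_mat_def)

lemma block_block_mat [simp]: "block (block_mat B) = B"
  by (simp add: block_def block_mat_def fun_eq_iff)

lemma block_zero: "block 0 i j = 0"
  and block_add: "block (A + B) i j = block A i j + block B i j"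
  and block_scale: "block (mat_scale c A) i j = mat_scale c (block A i j)"
  and block_adj: "block (mat_adj A) i j = mat_adj (block A j i)"
  by (simp_all add: block_def mat_adj_def mat_apply fun_eq_iff)

lemma block_id: "i \<in> N \<Longrightarrow> block (mat_id (N \<times> S)) i j = (if i = j then mat_id S else 0)"
  by (auto simp: block_def mat_id_def mat_apply fun_eq_iff)

lemma block_mult:
  "block (mat_mult (N \<times> S) A B) i j = (\<Sum>l\<in>N. mat_mult S (block A i l) (block B l j))"
  by (simp add: block_def mat_mult_def mat_sum_apply sum.cartesian_product' fun_eq_iff)

lemma block_mat_in_space:
  assumes "\<And>i j. B i j \<in> mat_space S" "\<And>i j. i \<notin> N \<or> j \<notin> N \<Longrightarrow> B i j = 0"
  shows "block_mat B \<in> mat_space (N \<times> S)"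
  using assms by (fastforce simp: mat_space_def mat_apply)

lemma mat_inner_block:
  "mat_inner (N \<times> S) A B = (\<Sum>i\<in>N. \<Sum>j\<in>N. mat_inner S (block A i j) (block B i j))"
proof -
  have "mat_inner (N \<times> S) A B
      = (\<Sum>i\<in>N. \<Sum>x\<in>S. \<Sum>j\<in>N. \<Sum>y\<in>S. cnj (A (i, x) (j, y)) * B (i, x) (j, y))"
    by (simp add: mat_inner_def sum.cartesian_product')
  also have "\<dots> = (\<Sum>i\<in>N. \<Sum>j\<in>N. mat_inner S (block A i j) (block B i j))"
    unfolding mat_inner_def block_def by (intro sum.cong refl sum.swap)
  finally show ?thesis .
qed

lemma mat_form_block:
  "mat_form (N \<times> S) (block_mat B) u v
    = (\<Sum>i\<in>N. \<Sum>j\<in>N. mat_form S (B i j) (\<lambda>x. u (i, x)) (\<lambda>y. v (j, y)))"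
proof -
  have "mat_form (N \<times> S) (block_mat B) u v
      = (\<Sum>i\<in>N. \<Sum>x\<in>S. \<Sum>j\<in>N. \<Sum>y\<in>S. cnj (u (i, x)) * B i j x y * v (j, y))"
    by (simp add: mat_form_def sum.cartesian_product')
  also have "\<dots> = (\<Sum>i\<in>N. \<Sum>j\<in>N. mat_form S (B i j) (\<lambda>x. u (i, x)) (\<lambda>y. v (j, y)))"
    unfolding mat_form_def by (intro sum.cong refl sum.swap)
  finally show ?thesis .
qed

definition cp_on :: "'i set \<Rightarrow> 'j set \<Rightarrow> ('i cmat \<Rightarrow> 'j cmat) \<Rightarrow> bool" where
  "cp_on S T \<Phi> \<longleftrightarrow> (\<forall>(n::nat) B. (\<forall>i j. B i j \<in> mat_space S) \<longrightarrow>
     psd_on ({..<n} \<times> S) (block_mat B) \<longrightarrow> psd_on ({..<n} \<times> T) (block_mat (\<lambda>i j. \<Phi> (B i j))))"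

context star_algebra
begin

definition block_algebra :: "'n set \<Rightarrow> ('n \<times> 'i) cmat set" where
  "block_algebra N = {A \<in> mat_space (N \<times> S). \<forall>i\<in>N. \<forall>j\<in>N. block A i j \<in> W}"

lemma star_algebra_block:
  assumes "finite N"
  shows "star_algebra (N \<times> S) (block_algebra N)"
proof
  show "mat.subspace (block_algebra N)"
    by (intro mat.subspaceI)
      (auto simp: block_algebra_def block_zero block_add block_scale
        intro!: mat_space_intros zero_in add_in scale_in)
  show "mat_id (N \<times> S) \<in> block_algebra N"
    by (auto simp: block_algebra_def block_id id_in mat_id_in_space zero_in)
  show "mat_mult (N \<times> S) A B \<in> block_algebra N"
    if "A \<in> block_algebra N" "B \<in> block_algebra N" for A B
    using that by (auto simp: block_algebra_def block_mult
      intro: mat_mult_in_space intro!: sum_in mult_in)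
  show "mat_adj A \<in> block_algebra N" if "A \<in> block_algebra N" for A
    using that by (auto simp: block_algebra_def block_adj intro: mat_adj_in_space adj_in)
qed (use assms finite_index in \<open>auto simp: block_algebra_def\<close>)

lemma block_proj:
  assumes "finite N" "i \<in> N" "j \<in> N"
  shows "block (mat_subspace.proj (N \<times> S) (block_algebra N) X) i j = proj (block X i j)"
proof -
  interpret blocks: star_algebra "N \<times> S" "block_algebra N"
    by (rule star_algebra_block[OF assms(1)])
  show ?thesis
  proof (rule proj_eqI[symmetric])
    show "block (blocks.proj X) i j \<in> W"
      using blocks.proj_in[of X] assms by (simp add: block_algebra_def)
    fix A assume A: "A \<in> W"
    define E where "E = block_mat (\<lambda>a b. if a = i \<and> b = j then A else 0)"
    have "E \<in> block_algebra N"
      using A subset_space assms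
      by (auto simp: E_def block_algebra_def zero_in intro!: block_mat_in_space mat_space_intros)
    moreover have "mat_inner (N \<times> S) E Y = mat_inner S A (block Y i j)" for Y
    proof -
      have "mat_inner (N \<times> S) E Y
          = (\<Sum>a\<in>N. \<Sum>b\<in>N. if b = j then if a = i then mat_inner S A (block Y i j) else 0 else 0)"
        unfolding mat_inner_block E_def block_block_mat by (intro sum.cong) auto
      then show ?thesis
        using assms by simp
    qed
    ultimately show "mat_inner S A (block X i j) = mat_inner S A (block (blocks.proj X) i j)"
      using blocks.mat_inner_proj[of E X] by simp
  qed
qed

lemma proj_blocks_eq_square:
  assumes N: "finite N" and psd: "psd_on (N \<times> S) (block_mat B)"
  shows "\<exists>C. (\<forall>l\<in>N. \<forall>i\<in>N. C l i \<in> W) \<and>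
    (\<forall>i\<in>N. \<forall>j\<in>N. proj (B i j) = (\<Sum>l\<in>N. mat_mult S (mat_adj (C l i)) (C l j)))"
proof -
  interpret blocks: star_algebra "N \<times> S" "block_algebra N"
    by (rule star_algebra_block[OF N])
  obtain C where C: "C \<in> block_algebra N" "blocks.proj (block_mat B) = mat_mult (N \<times> S) (mat_adj C) C"
    using blocks.proj_psd_eq_square[OF psd] by blast
  show ?thesis
  proof (intro exI[of _ "block C"] conjI ballI)
    show "block C l i \<in> W" if "l \<in> N" "i \<in> N" for l i
      using C(1) that by (simp add: block_algebra_def)
    fix i j assume "i \<in> N" "j \<in> N"
    then have "proj (B i j) = block (blocks.proj (block_mat B)) i j"
      by (simp add: block_proj N)
    then show "proj (B i j) = (\<Sum>l\<in>N. mat_mult S (mat_adj (block C l i)) (block C l j))"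
      by (simp add: C(2) block_mult block_adj)
  qed
qed

theorem cp_on_hom_proj:
  assumes add: "\<And>A B. A \<in> W \<Longrightarrow> B \<in> W \<Longrightarrow> \<phi> (A + B) = \<phi> A + \<phi> B"
    and mult: "\<And>A B. A \<in> W \<Longrightarrow> B \<in> W \<Longrightarrow> \<phi> (mat_mult S A B) = mat_mult T (\<phi> A) (\<phi> B)"
    and adj: "\<And>A. A \<in> W \<Longrightarrow> \<phi> (mat_adj A) = mat_adj (\<phi> A)"
  shows "cp_on S T (\<lambda>X. \<phi> (proj X))"
  unfolding cp_on_def
proof (intro allI impI)
  fix n :: nat and B assume psd: "psd_on ({..<n} \<times> S) (block_mat B)"
  obtain C where C: "\<forall>l<n. \<forall>i<n. C l i \<in> W"
    "\<forall>i<n. \<forall>j<n. proj (B i j) = (\<Sum>l<n. mat_mult S (mat_adj (C l i)) (C l j))"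
    using proj_blocks_eq_square[OF finite_lessThan psd] unfolding Ball_def lessThan_iff by blast
  have "\<phi> 0 = 0"
    using add[of 0 0] by (simp add: zero_in)
  then have sum: "\<phi> (\<Sum>l\<in>L. M l) = (\<Sum>l\<in>L. \<phi> (M l))" if "\<And>l. l \<in> L \<Longrightarrow> M l \<in> W" for L :: "nat set" and M
    using that by (induction L rule: infinite_finite_induct) (simp_all add: add sum_in)
  have image: "\<phi> (proj (B i j)) x y = (\<Sum>l<n. \<Sum>z\<in>T. cnj (\<phi> (C l i) z x) * \<phi> (C l j) z y)"
    if "i < n" "j < n" for i j x y
  proof -
    have "\<phi> (proj (B i j)) = \<phi> (\<Sum>l<n. mat_mult S (mat_adj (C l i)) (C l j))"
      using that C(2) by simp
    also have "\<dots> = (\<Sum>l<n. \<phi> (mat_mult S (mat_adj (C l i)) (C l j)))"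
      using that C(1) by (intro sum mult_in adj_in) auto
    also have "\<dots> = (\<Sum>l<n. mat_mult T (mat_adj (\<phi> (C l i))) (\<phi> (C l j)))"
      using that by (intro sum.cong refl) (simp add: mult adj adj_in C(1))
    finally show ?thesis
      by (simp add: mat_sum_apply mat_mult_def mat_adj_def)
  qed
  define D where "D = (\<lambda>(l, z) (i, x). \<phi> (C l i) z x)"
  have "psd_on ({..<n} \<times> T) (\<lambda>p q. \<Sum>r\<in>{..<n} \<times> T. cnj (D r p) * D r q)"
    by (rule psd_on_gram)
  then show "psd_on ({..<n} \<times> T) (block_mat (\<lambda>i j. \<phi> (proj (B i j))))"
    by (rule psd_on_cong[THEN iffD1, rotated]) (auto simp: D_def image sum.cartesian_product')
qed

end

section \<open>The multiplicative domain of a unital trace-preserving completely positive map\<close>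

text \<open>For a positive block matrix with corner \<open>M\<^sub>0\<^sub>0 = 1\<close>, this vector realises the
  Schur complement \<open>M\<^sub>1\<^sub>1 - M\<^sub>1\<^sub>0 M\<^sub>0\<^sub>1\<close> as a value of the form of \<open>M\<close>.\<close>
definition schur_vec :: "(nat \<Rightarrow> nat \<Rightarrow> 'i cmat) \<Rightarrow> 'i \<Rightarrow> nat \<times> 'i \<Rightarrow> complex" where
  "schur_vec M x = (\<lambda>(i, z). if i = 0 then - M 0 1 z x else if i = 1 then unit_vec x z else 0)"

context
  fixes T :: "'i set" and M :: "nat \<Rightarrow> nat \<Rightarrow> 'i cmat"
  assumes fin: "finite T" and corner: "M 0 0 = mat_id T" and psd: "psd_on ({..<3} \<times> T) (block_mat M)"
begin

lemma mat_form_schur_vec: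
  assumes "x \<in> T"
  shows "mat_form ({..<3} \<times> T) (block_mat M) (schur_vec M x) (schur_vec M x)
    = M 1 1 x x - mat_mult T (M 1 0) (M 0 1) x x"
  unfolding mat_form_block
  using assms fin
  by (simp add: schur_vec_def numeral_3_eq_3 corner mat_form_id mat_form_unit_left mat_form_unit_right
      sum_unit_vec mat_mult_def sum_negf)

lemma mat_form_schur_vec_row:
  assumes "x \<in> T" "y \<in> T"
  shows "mat_form ({..<3} \<times> T) (block_mat M) (unit_vec (2, y)) (schur_vec M x)
    = M 2 1 y x - mat_mult T (M 2 0) (M 0 1) y x"
proof -
  have "(\<lambda>z. unit_vec (2, y) (i, z)) = (if i = 2 then unit_vec y else (\<lambda>z. 0))" for i :: nat
    by (auto simp: unit_vec_def fun_eq_iff)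
  then show ?thesis
    unfolding mat_form_block
    using assms fin
    by (simp add: schur_vec_def numeral_3_eq_3 numeral_2_eq_2 mat_form_unit_left sum_unit_vec mat_mult_def)
qed

lemma schur_complement_diag_nonneg: "x \<in> T \<Longrightarrow> 0 \<le> M 1 1 x x - mat_mult T (M 1 0) (M 0 1) x x"
  using psd mat_form_schur_vec unfolding psd_on_def by metis

lemma schur_complement_row_zero:
  assumes "x \<in> T" "y \<in> T" and "M 1 1 x x = mat_mult T (M 1 0) (M 0 1) x x"
  shows "M 2 1 y x = mat_mult T (M 2 0) (M 0 1) y x"
  using psd_on_form_kernel[OF psd, of "schur_vec M x" "unit_vec (2, y)"] assms
  by (simp add: mat_form_schur_vec mat_form_schur_vec_row)

end

locale unital_tracial_cp_map =
  fixes S :: "'i set" and T :: "'j set" and \<Phi> :: "'i cmat \<Rightarrow> 'j cmat"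
  assumes finite_source: "finite S" and finite_target: "finite T"
    and maps: "X \<in> mat_space S \<Longrightarrow> \<Phi> X \<in> mat_space T"
    and map_add: "X \<in> mat_space S \<Longrightarrow> Y \<in> mat_space S \<Longrightarrow> \<Phi> (X + Y) = \<Phi> X + \<Phi> Y"
    and map_scale: "X \<in> mat_space S \<Longrightarrow> \<Phi> (mat_scale c X) = mat_scale c (\<Phi> X)"
    and cp: "cp_on S T \<Phi>"
    and unital: "\<Phi> (mat_id S) = mat_id T"
    and trace: "X \<in> mat_space S \<Longrightarrow> mat_inner T (mat_id T) (\<Phi> X) = mat_inner S (mat_id S) X"
begin

lemma map_zero: "\<Phi> 0 = 0"
  using map_scale[of 0 0] by (simp add: mat_space_intros)

lemma gram_image_psd:
  fixes C :: "nat \<Rightarrow> 'i cmat"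
  assumes "\<And>i. C i \<in> mat_space S"
  shows "psd_on ({..<n} \<times> T) (block_mat (\<lambda>i j. \<Phi> (mat_mult S (mat_adj (C i)) (C j))))"
proof -
  have "block_mat (\<lambda>i j. mat_mult S (mat_adj (C i)) (C j))
      = (\<lambda>p q. \<Sum>z\<in>S. cnj (C (fst p) z (snd p)) * C (fst q) z (snd q))"
    by (simp add: block_mat_def mat_mult_def mat_adj_def fun_eq_iff)
  then have "psd_on ({..<n} \<times> S) (block_mat (\<lambda>i j. mat_mult S (mat_adj (C i)) (C j)))"
    using psd_on_gram[of _ "\<lambda>z p. C (fst p) z (snd p)"] by simp
  then show ?thesis
    using cp assms unfolding cp_on_def by (simp add: mat_space_intros)
qed

lemma map_adj:
  assumes X: "X \<in> mat_space S"
  shows "\<Phi> (mat_adj X) = mat_adj (\<Phi> X)"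
proof (rule mat_eqI)
  define C where "C = (\<lambda>i::nat. if i = 0 then mat_id S else X)"
  have psd: "psd_on ({..<2} \<times> T) (block_mat (\<lambda>i j. \<Phi> (mat_mult S (mat_adj (C i)) (C j))))"
    by (rule gram_image_psd) (simp add: C_def X mat_id_in_space)
  fix x y assume "x \<in> T" "y \<in> T"
  then show "\<Phi> (mat_adj X) x y = mat_adj (\<Phi> X) x y"
    using psd_on_hermitian[OF psd, of "(0, y)" "(1, x)"] X finite_target
    by (simp add: C_def mat_mult_id_left mat_mult_id_right finite_source mat_space_intros
        mat_adj_def[of "\<Phi> X"])
qed (use X in \<open>auto intro: mat_space_intros maps\<close>)

definition isometric_domain :: "'i cmat set" where
  "isometric_domain = {X \<in> mat_space S. mat_inner T (\<Phi> X) (\<Phi> X) = mat_inner S X X}"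

lemma isometric_domain_space: "X \<in> isometric_domain \<Longrightarrow> X \<in> mat_space S"
  by (simp add: isometric_domain_def)

text \<open>The Schwarz defect \<open>\<Phi>(X\<^sup>* X) - \<Phi>(X)\<^sup>* \<Phi>(X) \<ge> 0\<close> has trace zero, so the Schur vectors of
  the image of the Gram matrix of \<open>1, X, A\<^sup>*\<close> lie in its kernel; read off the row of \<open>A\<^sup>*\<close>.\<close>
theorem map_mult:
  assumes A: "A \<in> mat_space S" and X: "X \<in> isometric_domain"
  shows "\<Phi> (mat_mult S A X) = mat_mult T (\<Phi> A) (\<Phi> X)"
proof (rule mat_eqI)
  have X_space: "X \<in> mat_space S" and iso: "mat_inner T (\<Phi> X) (\<Phi> X) = mat_inner S X X"
    using X by (auto simp: isometric_domain_def)
  define C where "C = (\<lambda>i::nat. if i = 0 then mat_id S else if i = 1 then X else mat_adj A)"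
  define M where "M = (\<lambda>i j. \<Phi> (mat_mult S (mat_adj (C i)) (C j)))"
  have psd: "psd_on ({..<3} \<times> T) (block_mat M)"
    unfolding M_def by (rule gram_image_psd) (simp add: C_def A X_space mat_space_intros)
  have M: "M 0 0 = mat_id T" "M 0 1 = \<Phi> X" "M 1 0 = mat_adj (\<Phi> X)" "M 2 0 = \<Phi> A"
    "M 1 1 = \<Phi> (mat_mult S (mat_adj X) X)" "M 2 1 = \<Phi> (mat_mult S A X)"
    using A X_space
    by (simp_all add: M_def C_def unital map_adj mat_mult_id_left mat_mult_id_right finite_source
        mat_space_intros)
  note schur_complement = schur_complement_diag_nonneg[of T M, OF finite_target M(1) psd]
    schur_complement_row_zero[of T M, OF finite_target M(1) psd]
  define d where "d = (\<lambda>x. M 1 1 x x - mat_mult T (M 1 0) (M 0 1) x x)"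
  have "(\<Sum>x\<in>T. d x) = mat_inner T (mat_id T) (\<Phi> (mat_mult S (mat_adj X) X)) - mat_inner T (\<Phi> X) (\<Phi> X)"
    by (simp add: d_def M mat_inner_eq_trace[of T "\<Phi> X"] mat_inner_id finite_target sum_subtractf
        maps X_space del: One_nat_def)
  also have "\<dots> = 0"
    using X_space by (simp add: trace iso mat_space_intros mat_inner_eq_trace[of S X] finite_source)
  finally have "(\<Sum>x\<in>T. d x) = 0" .
  then have d_zero: "d x = 0" if "x \<in> T" for x
    using schur_complement(1) that finite_target by (simp add: d_def sum_nonneg_eq_0_iff)
  fix y x assume "y \<in> T" "x \<in> T"
  then show "\<Phi> (mat_mult S A X) y x = mat_mult T (\<Phi> A) (\<Phi> X) y x"
    using schur_complement(2)[of x y] d_zero[of x] by (simp add: d_def M del: One_nat_def)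
qed (use A isometric_domain_space[OF X] in \<open>simp_all add: mat_space_intros maps\<close>)

lemma mat_inner_map:
  assumes A: "A \<in> mat_space S" and X: "X \<in> isometric_domain"
  shows "mat_inner T (\<Phi> A) (\<Phi> X) = mat_inner S A X"
proof -
  have "mat_inner T (\<Phi> A) (\<Phi> X) = mat_inner T (mat_id T) (\<Phi> (mat_mult S (mat_adj A) X))"
    using A X
    by (simp add: mat_inner_eq_trace[of T] finite_target maps map_mult map_adj mat_adj_in_space)
  also have "\<dots> = mat_inner S A X"
    using A isometric_domain_space[OF X]
    by (simp add: trace mat_space_intros mat_inner_eq_trace[of S A] finite_source)
  finally show ?thesis .
qed

lemma isometric_domain_mult:
  assumes X: "X \<in> isometric_domain" and Y: "Y \<in> isometric_domain"
  shows "mat_mult S X Y \<in> isometric_domain"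
proof -
  note space = isometric_domain_space[OF X] isometric_domain_space[OF Y]
  have "mat_inner T (\<Phi> (mat_mult S X Y)) (\<Phi> (mat_mult S X Y))
      = mat_inner T (\<Phi> Y) (mat_mult T (mat_mult T (\<Phi> (mat_adj X)) (\<Phi> X)) (\<Phi> Y))"
    using space Y by (simp add: map_mult map_adj mat_inner_mult_left mat_mult_assoc)
  also have "\<dots> = mat_inner T (\<Phi> Y) (\<Phi> (mat_mult S (mat_mult S (mat_adj X) X) Y))"
    using space X Y by (simp add: map_mult mat_space_intros)
  also have "\<dots> = cnj (mat_inner T (\<Phi> (mat_mult S (mat_mult S (mat_adj X) X) Y)) (\<Phi> Y))"
    by (simp add: cnj_mat_inner)
  also have "\<dots> = cnj (mat_inner S (mat_mult S (mat_mult S (mat_adj X) X) Y) Y)"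
    using space Y by (simp add: mat_inner_map mat_space_intros)
  also have "\<dots> = mat_inner S (mat_mult S X Y) (mat_mult S X Y)"
    by (simp add: cnj_mat_inner mat_inner_mult_left mat_mult_assoc)
  finally show ?thesis
    using space by (simp add: isometric_domain_def mat_mult_in_space)
qed

lemma star_algebra_isometric_domain: "star_algebra S isometric_domain"
proof
  show "mat.subspace isometric_domain"
  proof (rule mat.subspaceI)
    show "0 \<in> isometric_domain"
      by (simp add: isometric_domain_def map_zero mat_space_intros)
    show "mat_scale c X \<in> isometric_domain" if "X \<in> isometric_domain" for c X
      using that
      by (simp add: isometric_domain_def map_scale mat_space_intros mat_inner_scale_left
          mat_inner_scale_right)
    fix X Y assume XY: "X \<in> isometric_domain" "Y \<in> isometric_domain"
    then have space: "X \<in> mat_space S" "Y \<in> mat_space S"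
      by (auto dest: isometric_domain_space)
    with XY have "mat_inner T (\<Phi> (X + Y)) (\<Phi> (X + Y)) = mat_inner S (X + Y) (X + Y)"
      by (simp add: map_add mat_inner_map mat_inner_add_left mat_inner_add_right)
    moreover have "X + Y \<in> mat_space S"
      by (intro mat_space_intros space)
    ultimately show "X + Y \<in> isometric_domain"
      by (simp add: isometric_domain_def)
  qed
  show "mat_id S \<in> isometric_domain"
    using trace[OF mat_id_in_space] by (simp add: isometric_domain_def unital mat_id_in_space)
  show "mat_adj X \<in> isometric_domain" if "X \<in> isometric_domain" for X
    using that by (simp add: isometric_domain_def map_adj mat_inner_adj mat_adj_in_space)
qed (auto simp: finite_source isometric_domain_space intro: isometric_domain_mult)

lemma inj_on_isometric_domain: "inj_on \<Phi> isometric_domain"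
proof (rule inj_onI)
  interpret star_algebra S isometric_domain
    by (rule star_algebra_isometric_domain)
  fix X Y assume XY: "X \<in> isometric_domain" "Y \<in> isometric_domain" "\<Phi> X = \<Phi> Y"
  let ?D = "X - Y"
  have D: "?D \<in> isometric_domain"
    using XY by (intro diff_in)
  have "\<Phi> X = \<Phi> ?D + \<Phi> Y"
    using map_add[of ?D Y] XY(2) D by (simp add: isometric_domain_space)
  then have "\<Phi> ?D = 0"
    using XY(3) by simp
  then have "mat_inner S ?D ?D = 0"
    using mat_inner_map[OF isometric_domain_space[OF D] D] by simp
  then show "X = Y"
    using mat_inner_self_eq_0_iff[OF finite_source isometric_domain_space[OF D]] by simp
qed

end

section \<open>Matrices indexed by tuples\<close>

lemma finite_tuples [simp]: "finite (tuples k :: 'a::finite list set)"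
  using finite_lists_length_eq[of "UNIV :: 'a set" k] by (simp add: tuples_def)

lemma tmat_eqs:
  "tspace k = mat_space (tuples k)" "mzero = 0" "madd A B = A + B" "msmult = mat_scale"
  "mmult k = mat_mult (tuples k)" "mctrans = mat_adj" "mI k = mat_id (tuples k)"
  "munit = mat_unit" "tinner k = mat_inner (tuples k)"
proof -
  show "tinner k = mat_inner (tuples k)"
    unfolding fun_eq_iff tinner_def mtrace_def mmult_def mctrans_def mat_inner_def
    by (intro allI, rule sum.swap)
  show "tspace k = mat_space (tuples k)"
    by (auto simp: tspace_def mat_space_def tuples_def)
qed (simp_all add: tuples_def mzero_def madd_def msmult_def mmult_def mat_mult_def
    mctrans_def mat_adj_def mI_def mat_id_def munit_def mat_unit_def mat_apply fun_eq_iff)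

lemma mtrace_eq: "mtrace k A = mat_inner (tuples k) (mat_id (tuples k)) (A :: 'a::finite tmat)"
  by (simp add: mtrace_def mat_inner_id)

lemma block_psd_iff: "block_psd k n B \<longleftrightarrow> psd_on ({..<n} \<times> tuples k) (block_mat B)"
proof -
  let ?q = "\<lambda>v. \<Sum>i<n. \<Sum>j<n. mat_form (tuples k) (B i j) (v i) (v j)"
  have nonneg_iff: "Im q = 0 \<and> 0 \<le> Re q \<longleftrightarrow> 0 \<le> q" for q
    by (auto simp: less_eq_complex_def)
  have "block_psd k n B \<longleftrightarrow> (\<forall>v. 0 \<le> ?q v)"
    unfolding block_psd_def Let_def nonneg_iff mat_form_def ..
  also have "\<dots> \<longleftrightarrow> (\<forall>v. 0 \<le> ?q (curry v))"
  proof (intro iffI allI)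
    fix v assume "\<forall>v. 0 \<le> ?q (curry v)"
    from this[rule_format, of "case_prod v"] show "0 \<le> ?q v"
      by (simp only: curry_case_prod)
  qed simp
  also have "\<dots> \<longleftrightarrow> psd_on ({..<n} \<times> tuples k) (block_mat B)"
    by (simp add: psd_on_def mat_form_block curry_def)
  finally show ?thesis .
qed

lemma completely_positive_eq: "completely_positive k = cp_on (tuples k) (tuples k)"
  by (simp add: completely_positive_def cp_on_def block_psd_iff tmat_eqs fun_eq_iff)

lemma mat_inner_adjoint:
  fixes \<Phi> :: "'a::finite tmat \<Rightarrow> 'b tmat"
  assumes lin: "lin_on k \<Phi>" and X: "X \<in> mat_space (tuples k)"
  shows "mat_inner (tuples k) (\<Phi> X) Y = mat_inner (tuples k) X (adjoint k \<Phi> Y)"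
proof -
  let ?P = "\<lambda>X. X \<in> mat_space (tuples k) \<and>
    mat_inner (tuples k) (\<Phi> X) Y = mat_inner (tuples k) X (adjoint k \<Phi> Y)"
  have map_add: "\<Phi> (A + B) = \<Phi> A + \<Phi> B" and map_scale: "\<Phi> (mat_scale c A) = mat_scale c (\<Phi> A)"
    if "A \<in> mat_space (tuples k)" "B \<in> mat_space (tuples k)" for A B c
    using lin that unfolding lin_on_def tmat_eqs by blast+
  have "X \<in> mat.span ((\<lambda>(x, y). mat_unit x y) ` (tuples k \<times> tuples k))"
    using X by (simp add: mat_space_eq_span_units)
  then have "?P X"
  proof (induction rule: mat.span_induct_alt)
    case base
    then show ?case
      using map_scale[of 0 0 0] by (simp add: mat_space_intros)
  next
    case (step c U A)
    then obtain x y where U: "U = mat_unit x y" "x \<in> tuples k" "y \<in> tuples k"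
      by auto
    then have "U \<in> mat_space (tuples k)"
      by (simp add: mat_unit_in_space)
    moreover have "length x = k" "length y = k"
      using U by (simp_all add: tuples_def)
    then have "mat_inner (tuples k) (\<Phi> U) Y = mat_inner (tuples k) U (adjoint k \<Phi> Y)"
      using U by (simp add: mat_inner_unit_left adjoint_def tmat_eqs)
    ultimately show ?case
      using step.IH
      by (simp add: mat_space_intros map_add map_scale mat_inner_add_left mat_inner_scale_left)
  qed
  then show ?thesis
    by simp
qed

section \<open>Rotations of tuples\<close>

lemma rot_eq_cycle_of_list: "rot k = cycle_of_list (cyc_seq k)"
proof
  fix p
  let ?s = "cyc_seq k"
  have s: "distinct ?s" "length ?s = 2 * k" "set ?s = {..<2 * k}"
    by (auto simp: cyc_seq_def)
  show "rot k p = cycle_of_list ?s p"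
  proof (cases "p < 2 * k")
    case True
    then obtain i where i: "i < 2 * k" "p = ?s ! i"
      using s by (metis in_set_conv_nth lessThan_iff)
    have "(THE l. l < 2 * k \<and> ?s ! l = p) = i"
      unfolding i(2) by (rule the_equality) (use i(1) s(1,2) in \<open>auto simp: nth_eq_iff_index_eq\<close>)
    then have "rot k p = rotate1 ?s ! i"
      using True i s by (simp add: rot_def nth_rotate1)
    also have "\<dots> = map (cycle_of_list ?s) ?s ! i"
      using cyclic_rotation[OF s(1), of 1] by simp
    finally show ?thesis
      using i s by simp
  qed (simp add: rot_def id_outside_supp s)
qed

lemma rot_permutes: "rot k permutes {..<2 * k}"
proof -
  have "set (cyc_seq k) = {..<2 * k}"
    by (auto simp: cyc_seq_def)
  then show ?thesis
    using cycle_permutes[of "cyc_seq k"] by (simp add: rot_eq_cycle_of_list)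
qed

lemma cyc_group_permutes: "\<sigma> \<in> cyc_group k \<Longrightarrow> \<sigma> permutes {..<2 * k}"
  unfolding cyc_group_def using permutes_funpow[OF rot_permutes] by auto

lemma cyc_group_inv:
  assumes "\<sigma> \<in> cyc_group k"
  shows "inv \<sigma> \<in> cyc_group k"
proof -
  obtain j where j: "\<sigma> = rot k ^^ j"
    using assms by (auto simp: cyc_group_def)
  have "permutation (rot k)"
    using rot_permutes permutation_permutes by blast
  then obtain n where n: "rot k ^^ n = id" "n > j"
    by (rule permutation_is_nilpotent')
  have "rot k ^^ j \<circ> rot k ^^ (n - j) = id" "rot k ^^ (n - j) \<circ> rot k ^^ j = id"
    using n by (simp_all flip: funpow_add)
  then have "inv \<sigma> = rot k ^^ (n - j)"
    unfolding j by (rule inv_unique_comp)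
  then show ?thesis
    by (auto simp: cyc_group_def)
qed

lemma permute_list_inverse:
  assumes "\<sigma> permutes {..<length xs}"
  shows "permute_list (inv \<sigma>) (permute_list \<sigma> xs) = xs" "permute_list \<sigma> (permute_list (inv \<sigma>) xs) = xs"
  using assms
  by (simp_all flip: permute_list_compose add: permutes_inv permutes_inv_o)

lemma bij_betw_permute_list:
  assumes "\<sigma> permutes {..<n}"
  shows "bij_betw (permute_list \<sigma>) (tuples n) (tuples n)"
  by (rule bij_betw_byWitness[where f' = "permute_list (inv \<sigma>)"])
    (use assms in \<open>auto simp: tuples_def permute_list_inverse\<close>)

lemma pact_eq_permute_list:
  assumes \<sigma>: "\<sigma> permutes {..<2 * k}" and xy: "x \<in> tuples k" "y \<in> tuples k"
  shows "pact k \<sigma> X x y =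
    X (take k (permute_list (inv \<sigma>) (x @ y))) (drop k (permute_list (inv \<sigma>) (x @ y)))"
proof -
  have "inv_into {0..<2 * k} \<sigma> j = inv \<sigma> j" if "j < 2 * k" for j
  proof (rule inv_into_f_eq)
    show "inv \<sigma> j \<in> {0..<2 * k}"
      using permutes_in_image[OF permutes_inv[OF \<sigma>], of j] that by simp
  qed (simp_all add: permutes_inj_on[OF \<sigma>] permutes_inverses[OF \<sigma>])
  then have "map (\<lambda>j. (x @ y) ! inv_into {0..<2 * k} \<sigma> j) [0..<2 * k] = permute_list (inv \<sigma>) (x @ y)"
    using xy by (simp add: permute_list_def tuples_def mult_2)
  then show ?thesis
    using xy by (simp add: pact_def tuples_def Let_def)
qed

lemma pact_in_space: "pact k \<sigma> A \<in> mat_space (tuples k)"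
  by (auto simp: mat_space_def tuples_def pact_def)

lemma mat_inner_append:
  "mat_inner (tuples k) A B
    = (\<Sum>z\<in>tuples (2 * k). cnj (A (take k z) (drop k z)) * B (take k z) (drop k z))"
  unfolding mat_inner_def sum.cartesian_product
  by (rule sum.reindex_bij_witness[where j = "\<lambda>(x, y). x @ y" and i = "\<lambda>z. (take k z, drop k z)"])
    (auto simp: tuples_def)

lemma mat_inner_pact:
  assumes \<sigma>: "\<sigma> permutes {..<2 * k}"
  shows "mat_inner (tuples k) (pact k \<sigma> A) (pact k \<sigma> B) = mat_inner (tuples k) A B"
proof -
  let ?f = "\<lambda>z. cnj (A (take k z) (drop k z)) * B (take k z) (drop k z)"
  have "mat_inner (tuples k) (pact k \<sigma> A) (pact k \<sigma> B)
      = (\<Sum>z\<in>tuples (2 * k). ?f (permute_list (inv \<sigma>) z))"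
    unfolding mat_inner_append
  proof (intro sum.cong refl)
    fix z :: "'a list" assume "z \<in> tuples (2 * k)"
    then have "take k z \<in> tuples k" "drop k z \<in> tuples k"
      by (auto simp: tuples_def)
    then show "cnj (pact k \<sigma> A (take k z) (drop k z)) * pact k \<sigma> B (take k z) (drop k z)
        = ?f (permute_list (inv \<sigma>) z)"
      by (simp add: pact_eq_permute_list[OF \<sigma>])
  qed
  also have "\<dots> = (\<Sum>z\<in>tuples (2 * k). ?f z)"
    by (rule sum.reindex_bij_betw[OF bij_betw_permute_list[OF permutes_inv[OF \<sigma>]]])
  finally show ?thesis
    by (simp add: mat_inner_append)
qed

lemma pact_pact_inv:
  assumes \<sigma>: "\<sigma> permutes {..<2 * k}" and X: "X \<in> mat_space (tuples k)"
  shows "pact k \<sigma> (pact k (inv \<sigma>) X) = X"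
proof (rule mat_eqI[OF pact_in_space X])
  fix x y :: "'a list" assume xy: "x \<in> tuples k" "y \<in> tuples k"
  let ?z = "permute_list (inv \<sigma>) (x @ y)"
  have "take k ?z \<in> tuples k" "drop k ?z \<in> tuples k"
    using xy by (auto simp: tuples_def)
  moreover have "permute_list (inv (inv \<sigma>)) ?z = x @ y"
    using xy \<sigma> by (intro permute_list_inverse(1)) (simp add: permutes_inv tuples_def mult_2)
  ultimately show "pact k \<sigma> (pact k (inv \<sigma>) X) x y = X x y"
    using xy by (simp add: pact_eq_permute_list \<sigma> permutes_inv tuples_def)
qed

lemma mat_inner_pact_right:
  assumes "\<sigma> permutes {..<2 * k}" "A \<in> mat_space (tuples k)"
  shows "mat_inner (tuples k) A (pact k \<sigma> B) = mat_inner (tuples k) (pact k (inv \<sigma>) A) B"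
  using mat_inner_pact[OF assms(1), of "pact k (inv \<sigma>) A" B] by (simp add: pact_pact_inv assms)

section \<open>Homomorphism tensors\<close>

lemma bminors_labelled:
  assumes "F \<in> bminors F0" "bV F0 \<subseteq> set (bin F0) \<union> set (bout F0)"
  shows "bV F \<subseteq> set (bin F) \<union> set (bout F) \<and> length (bin F) = length (bin F0)
    \<and> length (bout F) = length (bout F0)"
  using assms by (induction rule: bminors.induct) auto

lemma Qk_labelled:
  assumes "F \<in> Qk k"
  shows "bV F \<subseteq> set (bin F) \<union> set (bout F)" "length (bin F) = k" "length (bout F) = k"
proof -
  have "bV F0 \<subseteq> set (bin F0) \<union> set (bout F0)" "length (bin F0) = k" "length (bout F0) = k"
    if "F0 \<in> {Cgraph k, Mgraph k}" for F0
    using that by (auto simp: Cgraph_def Mgraph_def)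
  moreover obtain F0 where "F0 \<in> {Cgraph k, Mgraph k}" "F \<in> bminors F0"
    using assms by (auto simp: Qk_def QP_def QS_def)
  ultimately show "bV F \<subseteq> set (bin F) \<union> set (bout F)" "length (bin F) = k" "length (bout F) = k"
    using bminors_labelled[of F F0] by auto
qed

lemma hom_tensor_in_space:
  assumes "F \<in> Qk k"
  shows "hom_tensor G F \<in> mat_space (tuples k)"
proof -
  have "hom_tensor G F x y = 0" if "x \<notin> tuples k \<or> y \<notin> tuples k" for x y
  proof -
    have "map h (bin F) \<noteq> x \<or> map h (bout F) \<noteq> y" for h :: "nat \<Rightarrow> 'a"
      using that Qk_labelled[OF assms] by (auto simp: tuples_def)
    then show ?thesis
      by (auto simp: hom_tensor_def card_eq_0_iff)
  qed
  then show ?thesis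
    by (simp add: mat_space_def)
qed

text \<open>In the minors of \<open>C\<^sub>k\<close> and \<open>M\<^sub>k\<close> every vertex carries a label, so at most one
  homomorphism has the prescribed values on the labels.\<close>
lemma hom_tensor_zero_or_one:
  assumes "F \<in> Qk k"
  shows "hom_tensor G F x y = 0 \<or> hom_tensor G F x y = 1"
proof -
  define A where "A = {h \<in> extensional (bV F). (\<forall>e\<in>bE F. \<forall>a\<in>e. \<forall>b\<in>e. a \<noteq> b \<longrightarrow> G (h a) (h b))
        \<and> map h (bin F) = x \<and> map h (bout F) = y}"
  have "h = h'" if "h \<in> A" "h' \<in> A" for h h'
  proof (rule extensionalityI[of _ "bV F"])
    show "h \<in> extensional (bV F)" "h' \<in> extensional (bV F)"
      using that by (auto simp: A_def)
    fix v assume "v \<in> bV F"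
    then have "v \<in> set (bin F) \<or> v \<in> set (bout F)"
      using Qk_labelled(1)[OF assms] by auto
    moreover have "map h (bin F) = map h' (bin F)" "map h (bout F) = map h' (bout F)"
      using that by (auto simp: A_def)
    ultimately show "h v = h' v"
      by auto
  qed
  then have "A = {} \<or> (\<exists>h. A = {h})"
    by blast
  then show ?thesis
    by (auto simp: hom_tensor_def A_def[symmetric])
qed

lemma cnj_hom_tensor: "cnj (hom_tensor G F x y) = hom_tensor G F x y"
  by (simp add: hom_tensor_def)

lemma mat_inner_hom_tensor_self:
  assumes "F \<in> Qk k"
  shows "mat_inner (tuples k) (hom_tensor G F) (hom_tensor G F)
    = mat_inner (tuples k) (mJ k) (hom_tensor G F)"
  unfolding mat_inner_def
proof (intro sum.cong refl)
  fix x y :: "'a list" assume "x \<in> tuples k" "y \<in> tuples k"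
  then show "cnj (hom_tensor G F x y) * hom_tensor G F x y = cnj (mJ k x y) * hom_tensor G F x y"
    using hom_tensor_zero_or_one[OF assms, of G x y] by (auto simp: mJ_def tuples_def)
qed

lemma mhad_in_space: "A \<in> mat_space S \<Longrightarrow> mhad P A \<in> mat_space S"
  by (auto simp: mat_space_def mhad_def)

lemma mat_inner_mhad_hom_tensor:
  "mat_inner S A (mhad (hom_tensor G F) B) = mat_inner S (mhad (hom_tensor G F) A) B"
  by (simp add: mat_inner_def mhad_def cnj_hom_tensor mult_ac)

lemma mJ_in_space: "mJ k \<in> mat_space (tuples k)"
  by (auto simp: mat_space_def tuples_def mJ_def)

lemma qalg_subset_space: "qalg k G \<subseteq> mat_space (tuples k)"
proof
  show "A \<in> mat_space (tuples k)" if "A \<in> qalg k G" for A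
    using that
    by (induction rule: qalg.induct)
      (auto simp: tmat_eqs mJ_in_space hom_tensor_in_space mhad_in_space pact_in_space mat_space_intros)
qed

lemma star_algebra_qalg: "star_algebra (tuples k) (qalg k (G :: 'a::finite \<Rightarrow> 'a \<Rightarrow> bool))"
proof
  show "qalg k G \<subseteq> mat_space (tuples k)"
    by (rule qalg_subset_space)
  show "mat.subspace (qalg k G)"
    using qalg.zero qalg.add qalg.smult unfolding tmat_eqs by (intro mat.subspaceI) blast+
  show "mat_id (tuples k) \<in> qalg k G"
    using qalg.I unfolding tmat_eqs .
  show "mat_mult (tuples k) A B \<in> qalg k G" if "A \<in> qalg k G" "B \<in> qalg k G" for A B
    using qalg.mult[OF that] unfolding tmat_eqs .
  show "mat_adj A \<in> qalg k G" if "A \<in> qalg k G" for A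
    using qalg.ctrans[OF that] unfolding tmat_eqs .
qed simp

section \<open>From quantum isomorphism maps to algebraic equivalence\<close>

locale quantum_isomorphism =
  fixes k :: nat and G :: "'a::finite \<Rightarrow> 'a \<Rightarrow> bool" and H :: "'b::finite \<Rightarrow> 'b \<Rightarrow> bool"
    and \<Phi> :: "'a tmat \<Rightarrow> 'b tmat"
  assumes qi_map: "level_qi_map k G H \<Phi>"
begin

lemma
  shows lin: "lin_on k \<Phi>"
    and adjoint_I: "adjoint k \<Phi> (mat_id (tuples k)) = mat_id (tuples k)"
    and adjoint_J: "adjoint k \<Phi> (mJ k) = mJ k"
    and map_J: "\<Phi> (mJ k) = mJ k"
    and map_hom_tensor: "F \<in> Qk k \<Longrightarrow> \<Phi> (hom_tensor G F) = hom_tensor H F"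
    and map_mhad: "F \<in> QP k \<Longrightarrow> X \<in> mat_space (tuples k) \<Longrightarrow>
      \<Phi> (mhad (hom_tensor G F) X) = mhad (hom_tensor H F) (\<Phi> X)"
    and map_pact: "\<sigma> \<in> cyc_group k \<Longrightarrow> X \<in> mat_space (tuples k) \<Longrightarrow> \<Phi> (pact k \<sigma> X) = pact k \<sigma> (\<Phi> X)"
  using qi_map unfolding level_qi_map_def tmat_eqs by blast+

lemma mat_inner_map_fixed:
  assumes "adjoint k \<Phi> Y = Z" "X \<in> mat_space (tuples k)"
  shows "mat_inner (tuples k) Y (\<Phi> X) = mat_inner (tuples k) Z X"
  using mat_inner_adjoint[OF lin assms(2), of Y] assms(1) by (metis cnj_mat_inner)

sublocale unital_tracial_cp_map "tuples k" "tuples k" \<Phi>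
proof
  show "mat_inner (tuples k) (mat_id (tuples k)) (\<Phi> X) = mat_inner (tuples k) (mat_id (tuples k)) X"
    if "X \<in> mat_space (tuples k)" for X
    by (rule mat_inner_map_fixed[OF adjoint_I that])
qed (use qi_map in \<open>auto simp: level_qi_map_def lin_on_def tmat_eqs completely_positive_eq\<close>)

sublocale source: star_algebra "tuples k" "qalg k G"
  by (rule star_algebra_qalg)

sublocale target: star_algebra "tuples k" "qalg k H"
  by (rule star_algebra_qalg)

sublocale domain: star_algebra "tuples k" isometric_domain
  by (rule star_algebra_isometric_domain)

lemma qalg_subset_isometric_domain: "qalg k G \<subseteq> isometric_domain"
proof
  show "A \<in> isometric_domain" if "A \<in> qalg k G" for A
    using that
  proof (induction rule: qalg.induct)
    case J
    show ?case
      using mat_inner_map_fixed[OF adjoint_J mJ_in_space]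
      by (simp add: isometric_domain_def map_J mJ_in_space)
  next
    case (hom F)
    then show ?case
      using mat_inner_map_fixed[OF adjoint_J hom_tensor_in_space[OF hom, of G]]
      by (simp add: isometric_domain_def map_hom_tensor mat_inner_hom_tensor_self hom_tensor_in_space)
  next
    case (had F A)
    let ?had = "mhad (hom_tensor G F)"
    have A: "A \<in> mat_space (tuples k)"
      by (rule isometric_domain_space[OF had.IH])
    have "mat_inner (tuples k) (\<Phi> (?had A)) (\<Phi> (?had A))
        = mat_inner (tuples k) (\<Phi> (?had (?had A))) (\<Phi> A)"
      using had.hyps A by (simp add: map_mhad mhad_in_space mat_inner_mhad_hom_tensor)
    also have "\<dots> = mat_inner (tuples k) (?had A) (?had A)"
      using had.IH A by (simp add: mat_inner_map mhad_in_space mat_inner_mhad_hom_tensor)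
    finally show ?case
      using A by (simp add: isometric_domain_def mhad_in_space)
  next
    case (perm \<sigma> A)
    then show ?case
      by (simp add: isometric_domain_def map_pact mat_inner_pact cyc_group_permutes pact_in_space)
  qed (auto simp: tmat_eqs intro: domain.zero_in domain.add_in domain.scale_in domain.id_in
      domain.mult_in domain.adj_in)
qed

lemma qalg_dom:
  assumes "A \<in> qalg k G"
  shows "A \<in> isometric_domain" "A \<in> mat_space (tuples k)"
  using assms qalg_subset_isometric_domain qalg_subset_space by blast+

lemma map_qalg:
  assumes "A \<in> qalg k G"
  shows "\<Phi> A \<in> qalg k H"
  using assms
  by (induction rule: qalg.induct)
    (simp_all add: tmat_eqs qalg_dom map_zero map_add map_scale map_mult map_adj unital
      map_J map_hom_tensor map_mhad map_pact target.zero_in target.add_in target.scale_in target.id_in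
      target.mult_in target.adj_in qalg.J qalg.hom qalg.had qalg.perm)

lemma qalg_subset_image:
  assumes "B \<in> qalg k H"
  shows "\<exists>A\<in>qalg k G. \<Phi> A = B"
  using assms
proof (induction rule: qalg.induct)
  case I
  show ?case using unital source.id_in unfolding tmat_eqs by blast
next
  case J
  show ?case using map_J qalg.J by blast
next
  case (hom F)
  then show ?case using map_hom_tensor qalg.hom by blast
next
  case zero
  show ?case using map_zero source.zero_in unfolding tmat_eqs by blast
next
  case (add A B)
  then show ?case using map_add source.add_in qalg_dom unfolding tmat_eqs by metis
next
  case (smult A c)
  then show ?case using map_scale source.scale_in qalg_dom unfolding tmat_eqs by metis
next
  case (mult A B)
  then show ?case using map_mult source.mult_in qalg_dom unfolding tmat_eqs by metis
next
  case (ctrans A)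
  then show ?case using map_adj source.adj_in qalg_dom unfolding tmat_eqs by metis
next
  case (had F A)
  then show ?case using map_mhad qalg.had qalg_dom by metis
next
  case (perm \<sigma> A)
  then show ?case using map_pact qalg.perm qalg_dom by metis
qed

theorem alg_equiv: "alg_equiv k G H"
proof -
  have "\<Phi> ` qalg k G = qalg k H"
    by (auto intro: map_qalg dest: qalg_subset_image)
  then have "bij_betw \<Phi> (qalg k G) (qalg k H)"
    using inj_on_subset[OF inj_on_isometric_domain qalg_subset_isometric_domain]
    by (simp add: bij_betw_def)
  then show ?thesis
    unfolding alg_equiv_def
    by (intro exI[of _ \<Phi>])
      (simp add: tmat_eqs mtrace_eq qalg_dom map_add map_scale map_mult map_adj unital
        map_J map_hom_tensor map_mhad map_pact trace)
qed

end

section \<open>From algebraic equivalence to quantum isomorphism maps\<close>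

locale algebraic_equivalence =
  fixes k :: nat and G :: "'a::finite \<Rightarrow> 'a \<Rightarrow> bool" and H :: "'b::finite \<Rightarrow> 'b \<Rightarrow> bool"
    and \<phi> :: "'a tmat \<Rightarrow> 'b tmat"
  assumes map_in: "A \<in> qalg k G \<Longrightarrow> \<phi> A \<in> qalg k H"
    and map_add: "A \<in> qalg k G \<Longrightarrow> B \<in> qalg k G \<Longrightarrow> \<phi> (A + B) = \<phi> A + \<phi> B"
    and map_scale: "A \<in> qalg k G \<Longrightarrow> \<phi> (mat_scale c A) = mat_scale c (\<phi> A)"
    and map_adj: "A \<in> qalg k G \<Longrightarrow> \<phi> (mat_adj A) = mat_adj (\<phi> A)"
    and map_mult: "A \<in> qalg k G \<Longrightarrow> B \<in> qalg k G \<Longrightarrow>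
      \<phi> (mat_mult (tuples k) A B) = mat_mult (tuples k) (\<phi> A) (\<phi> B)"
    and map_mhad: "F \<in> QP k \<Longrightarrow> A \<in> qalg k G \<Longrightarrow>
      \<phi> (mhad (hom_tensor G F) A) = mhad (hom_tensor H F) (\<phi> A)"
    and map_I: "\<phi> (mat_id (tuples k)) = mat_id (tuples k)"
    and map_J: "\<phi> (mJ k) = mJ k"
    and map_hom_tensor: "F \<in> Qk k \<Longrightarrow> \<phi> (hom_tensor G F) = hom_tensor H F"
    and map_pact: "\<sigma> \<in> cyc_group k \<Longrightarrow> A \<in> qalg k G \<Longrightarrow> \<phi> (pact k \<sigma> A) = pact k \<sigma> (\<phi> A)"
    and trace: "A \<in> qalg k G \<Longrightarrow>
      mat_inner (tuples k) (mat_id (tuples k)) (\<phi> A) = mat_inner (tuples k) (mat_id (tuples k)) A"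
begin

sublocale star_algebra "tuples k" "qalg k G"
  by (rule star_algebra_qalg)

lemma mat_inner_map:
  assumes "A \<in> qalg k G" "B \<in> qalg k G"
  shows "mat_inner (tuples k) (\<phi> A) (\<phi> B) = mat_inner (tuples k) A B"
proof -
  have "A \<in> mat_space (tuples k)" "\<phi> A \<in> mat_space (tuples k)"
    using assms(1) map_in qalg_subset_space by blast+
  then show ?thesis
    using trace[of "mat_mult (tuples k) (mat_adj A) B"] assms
    by (simp add: mat_inner_eq_trace[of "tuples k" A] mat_inner_eq_trace[of "tuples k" "\<phi> A"]
        map_mult map_adj mult_in adj_in)
qed

lemma proj_mhad: "F \<in> QP k \<Longrightarrow> proj (mhad (hom_tensor G F) X) = mhad (hom_tensor G F) (proj X)"
  by (rule proj_commute) (auto intro: qalg.had simp: mat_inner_mhad_hom_tensor)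

lemma proj_pact: "\<sigma> \<in> cyc_group k \<Longrightarrow> proj (pact k \<sigma> X) = pact k \<sigma> (proj X)"
  using qalg_subset_space
  by (intro proj_commute[where T' = "pact k (inv \<sigma>)"])
    (auto intro: qalg.perm cyc_group_inv mat_inner_pact_right cyc_group_permutes)

lemma adjoint_map_proj:
  assumes A: "A \<in> qalg k G"
  shows "adjoint k (\<lambda>X. \<phi> (proj X)) (\<phi> A) = A"
proof (rule mat_eqI)
  show "adjoint k (\<lambda>X. \<phi> (proj X)) (\<phi> A) \<in> mat_space (tuples k)"
    by (auto simp: mat_space_def adjoint_def tuples_def)
  fix x y :: "'a list" assume xy: "x \<in> tuples k" "y \<in> tuples k"
  then have "adjoint k (\<lambda>X. \<phi> (proj X)) (\<phi> A) x y
      = mat_inner (tuples k) (\<phi> (proj (mat_unit x y))) (\<phi> A)"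
    by (simp add: adjoint_def tmat_eqs) (simp add: tuples_def)
  also have "\<dots> = A x y"
    using A xy by (simp add: mat_inner_map proj_in mat_inner_proj_left mat_inner_unit_left)
  finally show "adjoint k (\<lambda>X. \<phi> (proj X)) (\<phi> A) x y = A x y" .
qed (use A subset_space in blast)

theorem level_qi_map: "level_qi_map k G H (\<lambda>X. \<phi> (proj X))"
  unfolding level_qi_map_def tmat_eqs completely_positive_eq
proof (intro conjI ballI)
  have J: "mJ k \<in> qalg k G"
    by (rule qalg.J)
  show "(\<lambda>X. \<phi> (proj X)) ` mat_space (tuples k) \<subseteq> mat_space (tuples k)"
    using map_in[OF proj_in] qalg_subset_space by blast
  show "lin_on k (\<lambda>X. \<phi> (proj X))"
    by (simp add: lin_on_def tmat_eqs proj_add proj_scale map_add map_scale proj_in)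
  show "cp_on (tuples k) (tuples k) (\<lambda>X. \<phi> (proj X))"
    by (rule cp_on_hom_proj) (simp_all add: map_add map_mult map_adj)
  show "\<phi> (proj (mat_id (tuples k))) = mat_id (tuples k)" "\<phi> (proj (mJ k)) = mJ k"
    by (simp_all add: proj_id id_in J map_I map_J)
  show "adjoint k (\<lambda>X. \<phi> (proj X)) (mat_id (tuples k)) = mat_id (tuples k)"
    using adjoint_map_proj[OF id_in] by (simp add: map_I)
  show "adjoint k (\<lambda>X. \<phi> (proj X)) (mJ k) = mJ k"
    using adjoint_map_proj[OF J] by (simp add: map_J)
qed (simp_all add: proj_in proj_id proj_mhad proj_pact qalg.hom map_mhad map_pact map_hom_tensor)

end

lemma alg_equiv_imp_algebraic_equivalence:
  fixes G :: "'a::finite \<Rightarrow> 'a \<Rightarrow> bool" and H :: "'b::finite \<Rightarrow> 'b \<Rightarrow> bool"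
  assumes "alg_equiv k G H"
  shows "\<exists>\<phi>. algebraic_equivalence k G H \<phi>"
  using assms unfolding alg_equiv_def tmat_eqs mtrace_eq
  by (elim ex_forward) (auto simp: algebraic_equivalence_def bij_betw_def)

theorem theorem3p10:
  fixes k :: nat
    and G :: "'a::finite \<Rightarrow> 'a \<Rightarrow> bool"
    and H :: "'b::finite \<Rightarrow> 'b \<Rightarrow> bool"
  assumes "k \<ge> 1"
    and "simple_graph G" and "simple_graph H"
    and "CARD('a) = CARD('b)"
  shows "alg_equiv k G H \<longleftrightarrow> (\<exists>\<Phi>. level_qi_map k G H \<Phi>)"
proof
  assume "alg_equiv k G H"
  then obtain \<phi> where "algebraic_equivalence k G H \<phi>"
    using alg_equiv_imp_algebraic_equivalence by blast
  then show "\<exists>\<Phi>. level_qi_map k G H \<Phi>"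
    by (blast intro: algebraic_equivalence.level_qi_map)
next
  assume "\<exists>\<Phi>. level_qi_map k G H \<Phi>"
  then obtain \<Phi> where "quantum_isomorphism k G H \<Phi>"
    by (auto simp: quantum_isomorphism_def)
  then show "alg_equiv k G H"
    by (rule quantum_isomorphism.alg_equiv)
qed

end
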